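(* Let $T=(V,E)$ be a rooted tree with $n$ leaves such that each inner node has degree at most three. Then $\mathcal{M}_T^\kappa$ (the general Markov model on $T$ expressed in tree cumulants) is the image of the map $\psi_T:\Omega_T\to\mathcal{K}_T$ defined, for $\omega=((\bar\mu_v)_{v\in V},(\eta_{u,v})_{(u,v)\in E})\in\Omega_T$, by $\lambda_i=\frac12(1-\bar\mu_i)$ for $i=1,\ldots,n$ and $$\kappa_I=\frac14\bigl(1-\bar\mu_{r(I)}^2\bigr)\prod_{v\in V(I)\setminus I}\bar\mu_v^{\deg(v)-2}\prod_{(u,v)\in E(I)}\eta_{u,v}\qquad\text{for each } I\subseteq\{1,\ldots,n\}\text{ with }|I|\ge 2,$$ where the degree $\deg(v)$ is taken in the subtree $T(I)=(V(I),E(I))$ and $r(I)$ denotes the root of $T(I)$.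
   Context: Trees. A leaf is a node of degree one; other nodes are inner. $T=(V,E)$ has a distinguished node $r$ (the root) and all edges are directed away from $r$; $\mathrm{pa}(v)$ is the parent of $v\ne r$ and $\mathrm{pa}(r)=\emptyset$. The leaves are identified with $[n]=\{1,\ldots,n\}$. For $I\subseteq[n]$, $T(I)=(V(I),E(I))$ is the minimal subtree of $T$ whose node set contains $I$, and $r(I)$ is the unique node $v\in V(I)$ with $\mathrm{pa}(v)\cap V(I)=\emptyset$. Convention: $x^0=1$ for all $x$, including $x=0$. Model. All variables $Y_v$, $v\in V$, are binary with values in $\{0,1\}$; $X=(X_1,\ldots,X_n)$ is the subvector at the leaves. The parameter space is $\Theta_T=[0,1]^{2|E|+1}$, with free parameters $\theta^{(r)}_1=P(Y_r=1)$ and $\theta^{(v)}_{1|i}=P(Y_v=1\mid Y_u=i)$ for $(u,v)\in E$, $i\in\{0,1\}$ (and $\theta^{(r)}_0=1-\theta^{(r)}_1$, $\theta^{(v)}_{0|i}=1-\theta^{(v)}_{1|i}$). The map $f_T:\Theta_T\to\Delta_{2^n-1}$ into the simplex of probability distributions on $\{0,1\}^n$ is $p_\beta(\theta)=\sum_{\alpha}\prod_{v\in V}\theta^{(v)}_{\alpha_v|\alpha_{\mathrm{pa}(v)}}$, the sum being over all $\alpha\in\{0,1\}^V$ whose restriction to the leaves is $\beta$. The general Markov model is $\mathcal{M}_T=f_T(\Theta_T)$. New parameters. Given $\theta\in\Theta_T$ let $\lambda_v=E(Y_v)$ (a polynomial in $\theta$), $\bar\mu_v=1-2\lambda_v$ for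 $v\in V$, and $\eta_{u,v}=\theta^{(v)}_{1|1}-\theta^{(v)}_{1|0}$ for $(u,v)\in E$. $\Omega_T\subset\mathbb{R}^{|V|+|E|}$ is the image of $\Theta_T$ under $\theta\mapsto((\bar\mu_v),(\eta_{u,v}))$; this map is a polynomial isomorphism $\Theta_T\to\Omega_T$. Tree cumulants. For a distribution of $X$, let $\lambda_i=E(X_i)$ and $\mu_I=E\prod_{i\in I}(X_i-\lambda_i)$ for $I\subseteq[n]$. For $I\subseteq[n]$ with $|I|\geq 2$, $\Pi_{T(I)}$ is the poset of edge partitions of $I$: the partitions of $I$ obtained by removing some subset of edges of $T(I)$ and restricting $I$ to the connected components of the resulting forest (non-empty restrictions only), ordered by refinement ($\pi\le\nu$ if every block of $\pi$ is contained in a block of $\nu$). Its maximal element is the one-block partition $\hat 1_I$. Let $\mathfrak{m}_I$ be its Möbius function: $\mathfrak{m}_I(\pi,\pi)=1$ and $\mathfrak{m}_I(\pi,\nu)=-\sum_{\pi\le\delta<\nu}\mathfrak{m}_I(\pi,\delta)$ for $\pi<\nu$. The tree cumulants are $$\kappa_I=\sum_{\pi\in\Pi_{T(I)}}\mathfrak{m}_I(\pi,\hat 1_I)\prod_{B\in\pi}\mu_B .$$ $\mathcal{K}_T$ is the set of all values of $(\lambda_1,\ldots,\lambda_n,(\kappa_I)_{|I|\ge2})$ over all distributions in $\Delta_{2^n-1}$ (these are coordinates, related to the probabilities by a polynomial isomorphism), and $\mathcal{M}_T^\kappa\subseteq\mathcal{K}_T$ is the image of $\mathcal{M}_T$ under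 this change of coordinates. *)

theory Defs
  imports
    "Graph_Theory.Digraph_Component"
    "HOL-Library.Disjoint_Sets"
    "HOL-Library.FuncSet"
begin

section \<open>Rooted trees\<close>

text \<open>
  The predicate \<^const>\<open>tree\<close> of the library only excludes directed cycles, and in a symmetric
  digraph it counts \<open>a, b, a\<close> as a cycle, so neither form expresses that the underlying
  undirected graph is a tree. Here every undirected edge is represented by exactly one arc
  (hence \<^const>\<open>asym\<close>, which also excludes loops), and the undirected cycles are the cycles
  of length at least three in the symmetric closure.
\<close>

definition undirected_tree :: "'v pair_pre_digraph \<Rightarrow> bool" where
  "undirected_tree G \<longleftrightarrow>
     pair_fin_digraph G \<and> asym (parcs G) \<and>
     Digraph_Component.connected (with_proj G) \<and>
     \<not> (\<exists>p. pre_digraph.cycle (with_proj (mk_symmetric (with_proj G))) p \<and> length p \<ge> 3)"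

text \<open>
  Paths in a tree are unique, so a directed path from \<open>r\<close> to every node
  means that all edges point away from \<open>r\<close>.
\<close>

definition rooted_tree :: "'v pair_pre_digraph \<Rightarrow> 'v \<Rightarrow> bool" where
  "rooted_tree T r \<longleftrightarrow>
     undirected_tree T \<and> r \<in> pverts T \<and> (\<forall>v \<in> pverts T. r \<rightarrow>\<^sup>*\<^bsub>with_proj T\<^esub> v)"

definition degree :: "'v pair_pre_digraph \<Rightarrow> 'v \<Rightarrow> nat" where
  "degree G v = in_degree (with_proj G) v + out_degree (with_proj G) v"

text \<open>
  The leaves serve as their own labels: the index set \<open>[n]\<close> is the set \<open>leaves T\<close>, and \<open>n\<close>
  is its cardinality.
\<close>

definition leaves :: "'v pair_pre_digraph \<Rightarrow> 'v set" where
  "leaves T = {v \<in> pverts T. degree T v = 1}"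

text \<open>As a set, so that the root has parent \<open>{}\<close> and any other node \<open>v\<close> has \<open>{u}\<close> with \<open>u \<rightarrow> v\<close>.\<close>

definition pa :: "'v pair_pre_digraph \<Rightarrow> 'v \<Rightarrow> 'v set" where
  "pa T v = {u. (u, v) \<in> parcs T}"

text \<open>\<open>T(I)\<close>; only meaningful for nonempty \<open>I\<close>, where a least such subtree exists.\<close>

definition subtree_containing ::
  "'v pair_pre_digraph \<Rightarrow> 'v set \<Rightarrow> 'v pair_pre_digraph \<Rightarrow> bool" where
  "subtree_containing T I S \<longleftrightarrow>
     subgraph (with_proj S) (with_proj T) \<and> undirected_tree S \<and> I \<subseteq> pverts S"

definition min_subtree :: "'v pair_pre_digraph \<Rightarrow> 'v set \<Rightarrow> 'v pair_pre_digraph" where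
  "min_subtree T I =
     (THE S. subtree_containing T I S \<and>
        (\<forall>S'. subtree_containing T I S' \<longrightarrow> subgraph (with_proj S) (with_proj S')))"

definition subtree_root :: "'v pair_pre_digraph \<Rightarrow> 'v set \<Rightarrow> 'v" where
  "subtree_root T I =
     (THE v. v \<in> pverts (min_subtree T I) \<and> pa T v \<inter> pverts (min_subtree T I) = {})"


section \<open>The general Markov model\<close>

definition states :: "'v set \<Rightarrow> ('v \<Rightarrow> nat) set" where
  "states A = A \<rightarrow>\<^sub>E {0, 1}"

definition expect :: "'v set \<Rightarrow> (('v \<Rightarrow> nat) \<Rightarrow> real) \<Rightarrow> (('v \<Rightarrow> nat) \<Rightarrow> real) \<Rightarrow> real" where
  "expect A p f = (\<Sum>x\<in>states A. p x * f x)"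

text \<open>The probability simplex on \<open>{0,1}\<^sup>A\<close>, as a set of points with coordinates indexed by \<open>states A\<close>.\<close>

definition distributions :: "'v set \<Rightarrow> (('v \<Rightarrow> nat) \<Rightarrow> real) set" where
  "distributions A =
     {p \<in> extensional (states A). (\<forall>x\<in>states A. p x \<ge> 0) \<and> (\<Sum>x\<in>states A. p x) = 1}"

text \<open>
  A parameter \<open>\<theta>\<close> is the pair of the root parameter \<open>P(Y\<^sub>r = 1)\<close> and the family of
  conditional probabilities \<open>P(Y\<^sub>v = 1 | Y\<^sub>u = i)\<close>, indexed by \<open>((u, v), i)\<close>.
\<close>

type_synonym 'v params = "real \<times> (('v \<times> 'v) \<times> nat \<Rightarrow> real)"

definition param_space :: "'v pair_pre_digraph \<Rightarrow> 'v params set" where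
  "param_space T = {0..1} \<times> (parcs T \<times> {0, 1} \<rightarrow>\<^sub>E {0..1})"

text \<open>\<open>node_prob T r \<theta> v \<alpha>\<close> is the factor of node \<open>v\<close> in the joint probability of \<open>\<alpha>\<close>.\<close>

definition node_prob ::
  "'v pair_pre_digraph \<Rightarrow> 'v \<Rightarrow> 'v params \<Rightarrow> 'v \<Rightarrow> ('v \<Rightarrow> nat) \<Rightarrow> real" where
  "node_prob T r \<theta> v \<alpha> =
     (let q = (if v = r then fst \<theta>
               else (let u = the_elem (pa T v) in snd \<theta> ((u, v), \<alpha> u)))
      in if \<alpha> v = 1 then q else 1 - q)"

definition joint ::
  "'v pair_pre_digraph \<Rightarrow> 'v \<Rightarrow> 'v params \<Rightarrow> ('v \<Rightarrow> nat) \<Rightarrow> real" where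
  "joint T r \<theta> \<alpha> = (\<Prod>v\<in>pverts T. node_prob T r \<theta> v \<alpha>)"

definition model_map ::
  "'v pair_pre_digraph \<Rightarrow> 'v \<Rightarrow> 'v params \<Rightarrow> (('v \<Rightarrow> nat) \<Rightarrow> real)" where
  "model_map T r \<theta> =
     (\<lambda>\<beta>\<in>states (leaves T).
        \<Sum>\<alpha> | \<alpha> \<in> states (pverts T) \<and> restrict \<alpha> (leaves T) = \<beta>. joint T r \<theta> \<alpha>)"

definition markov_model :: "'v pair_pre_digraph \<Rightarrow> 'v \<Rightarrow> (('v \<Rightarrow> nat) \<Rightarrow> real) set" where
  "markov_model T r = model_map T r ` param_space T"


section \<open>The parameters \<open>\<omega>\<close>\<close>

definition node_mean :: "'v pair_pre_digraph \<Rightarrow> 'v \<Rightarrow> 'v params \<Rightarrow> 'v \<Rightarrow> real" where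
  "node_mean T r \<theta> v = expect (pverts T) (joint T r \<theta>) (\<lambda>\<alpha>. real (\<alpha> v))"

type_synonym 'v new_params = "('v \<Rightarrow> real) \<times> ('v \<times> 'v \<Rightarrow> real)"

definition reparam :: "'v pair_pre_digraph \<Rightarrow> 'v \<Rightarrow> 'v params \<Rightarrow> 'v new_params" where
  "reparam T r \<theta> =
     (\<lambda>v\<in>pverts T. 1 - 2 * node_mean T r \<theta> v,
      \<lambda>e\<in>parcs T. snd \<theta> (e, 1) - snd \<theta> (e, 0))"

definition new_param_space :: "'v pair_pre_digraph \<Rightarrow> 'v \<Rightarrow> 'v new_params set" where
  "new_param_space T r = reparam T r ` param_space T"


section \<open>Tree cumulants\<close>

definition leaf_mean ::
  "'v pair_pre_digraph \<Rightarrow> (('v \<Rightarrow> nat) \<Rightarrow> real) \<Rightarrow> 'v \<Rightarrow> real" where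
  "leaf_mean T p i = expect (leaves T) p (\<lambda>x. real (x i))"

definition central_moment ::
  "'v pair_pre_digraph \<Rightarrow> (('v \<Rightarrow> nat) \<Rightarrow> real) \<Rightarrow> 'v set \<Rightarrow> real" where
  "central_moment T p I = expect (leaves T) p (\<lambda>x. \<Prod>i\<in>I. real (x i) - leaf_mean T p i)"

definition remove_edges :: "'v pair_pre_digraph \<Rightarrow> ('v \<times> 'v) set \<Rightarrow> 'v pair_pre_digraph" where
  "remove_edges G F = \<lparr> pverts = pverts G, parcs = parcs G - F \<rparr>"

text \<open>The node sets of the connected components of the underlying undirected graph.\<close>

definition components :: "'v pair_pre_digraph \<Rightarrow> 'v set set" where
  "components G = pre_digraph.sccs_verts (with_proj (mk_symmetric (with_proj G)))"

definition edge_partitions :: "'v pair_pre_digraph \<Rightarrow> 'v set \<Rightarrow> 'v set set set" where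
  "edge_partitions T I =
     {{C \<inter> I | C. C \<in> components (remove_edges (min_subtree T I) F)} - {{}}
       | F. F \<subseteq> parcs (min_subtree T I)}"

definition edge_partition_order ::
  "'v pair_pre_digraph \<Rightarrow> 'v set \<Rightarrow> ('v set set \<times> 'v set set) set" where
  "edge_partition_order T I =
     {(\<pi>, \<nu>). \<pi> \<in> edge_partitions T I \<and> \<nu> \<in> edge_partitions T I \<and> refines I \<pi> \<nu>}"

text \<open>
  The Moebius function of a finite partial order, given as the relation \<open>{(x, y). x \<le> y}\<close>.
  The guard only serves termination.
\<close>

function moebius :: "('a \<times> 'a) set \<Rightarrow> 'a \<Rightarrow> 'a \<Rightarrow> real" where
  "moebius R x y =
     (if x = y then 1
      else if finite R \<and> antisym R \<and> trans R
      then - (\<Sum>z | (x, z) \<in> R \<and> (z, y) \<in> R \<and> z \<noteq> y. moebius R x z)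
      else 0)"
  by pat_completeness auto
termination
proof (relation "measure (\<lambda>(R, x, y). card {w. (w, y) \<in> R \<and> w \<noteq> y})", goal_cases)
  case 1
  show ?case by simp
next
  case (2 R x y z)
  have fin: "finite {w. (w, y) \<in> R \<and> w \<noteq> y}"
    by (rule finite_subset[of _ "fst ` R"]) (use 2 in force)+
  have "{w. (w, z) \<in> R \<and> w \<noteq> z} \<subset> {w. (w, y) \<in> R \<and> w \<noteq> y}"
    using 2 by (auto dest: antisymD transD)
  with fin show ?case
    by (simp add: psubset_card_mono)
qed

declare moebius.simps [simp del]

definition tree_cumulant ::
  "'v pair_pre_digraph \<Rightarrow> (('v \<Rightarrow> nat) \<Rightarrow> real) \<Rightarrow> 'v set \<Rightarrow> real" where
  "tree_cumulant T p I =
     (\<Sum>\<pi>\<in>edge_partitions T I.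
        moebius (edge_partition_order T I) \<pi> {I} * (\<Prod>B\<in>\<pi>. central_moment T p B))"

text \<open>Coordinates \<open>((\<lambda>\<^sub>i)\<^sub>i, (\<kappa>\<^sub>I)\<^sub>I)\<close> with \<open>i\<close> a leaf and \<open>I\<close> a set of at least two leaves.\<close>

type_synonym 'v cumulants = "('v \<Rightarrow> real) \<times> ('v set \<Rightarrow> real)"

definition index_sets :: "'v pair_pre_digraph \<Rightarrow> 'v set set" where
  "index_sets T = {I. I \<subseteq> leaves T \<and> card I \<ge> 2}"

definition cumulant_coords ::
  "'v pair_pre_digraph \<Rightarrow> (('v \<Rightarrow> nat) \<Rightarrow> real) \<Rightarrow> 'v cumulants" where
  "cumulant_coords T p =
     (\<lambda>i\<in>leaves T. leaf_mean T p i, \<lambda>I\<in>index_sets T. tree_cumulant T p I)"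

definition cumulant_space :: "'v pair_pre_digraph \<Rightarrow> 'v cumulants set" where
  "cumulant_space T = cumulant_coords T ` distributions (leaves T)"

definition cumulant_model :: "'v pair_pre_digraph \<Rightarrow> 'v \<Rightarrow> 'v cumulants set" where
  "cumulant_model T r = cumulant_coords T ` markov_model T r"


section \<open>The parametrization in tree cumulants\<close>

definition psi :: "'v pair_pre_digraph \<Rightarrow> 'v new_params \<Rightarrow> 'v cumulants" where
  "psi T = (\<lambda>(\<mu>, \<eta>).
     (\<lambda>i\<in>leaves T. 1/2 * (1 - \<mu> i),
      \<lambda>I\<in>index_sets T.
        let S = min_subtree T I in
          1/4 * (1 - (\<mu> (subtree_root T I))\<^sup>2)
          * (\<Prod>v\<in>pverts S - I. \<mu> v ^ (degree S v - 2))
          * (\<Prod>e\<in>parcs S. \<eta> e)))"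

end

(* A node whose parent has mean lambda_u and state y_u has conditional probability
   p_v(y) + (-1)^(1-y) eta_uv (y_u - lambda_u), where p_v is the marginal law. Expanding the joint
   probability over the set F of edges for which the second summand is chosen makes every moment
   of the leaves a sum over edge sets F of products of local factors. A node that meets F in exactly
   one edge and is not in the index set, or that is in the index set and meets no edge of F,
   contributes 0, so only those F survive whose components are subtrees T(B) spanned by the blocks B
   of an edge partition of I. Hence the product of the central moments over the blocks of an edge
   partition pi is the sum of the weights of the F whose partition refines pi, and Moebius inversion
   isolates the single edge set F = E(T(I)), whose weight is the monomial of the theorem. With all
   degrees at most three only the moments of order at most three of a Bernoulli variable occur. *)
theory Submission
  imports Defs
begin

section \<open>Rooted trees as relations\<close>

text \<open>The formula is proved for each parameter separately, as a polynomial identity: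
  \<open>psi T (reparam T r \<theta>)\<close> equals the cumulant coordinates of
  \<open>model_map T r \<theta>\<close>. Nothing is divided by, so vanishing slopes and means 0 or 1
  need no separate treatment, and the two images agree at once. The obstacle is that many edge sets
  induce the same edge partition, so a sum over edge sets is not yet a sum over the poset. The
  vanishing of local factors removes this ambiguity: every edge of a surviving set separates two
  indices which that set connects. Refinement of partitions thereby becomes an inclusion of edge
  sets, and the edge sets below a partition factor over the disjoint subtrees spanned by its
  blocks.\<close>

locale rooted_arborescence =
  fixes V :: "'v set" and E :: "('v \<times> 'v) set" and r :: 'v
  assumes finite_V: "finite V"
    and E_subset: "E \<subseteq> V \<times> V"
    and root_in_V: "r \<in> V"
    and reach: "v \<in> V \<Longrightarrow> (r, v) \<in> E\<^sup>*"
    and acyclic_E: "acyclic E"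
    and parent_unique: "(u, v) \<in> E \<Longrightarrow> (u', v) \<in> E \<Longrightarrow> u = u'"
begin

text \<open>Meaningful only below the root; at \<open>r\<close> the value is unspecified.\<close>

definition par :: "'v \<Rightarrow> 'v" where
  "par v = (THE u. (u, v) \<in> E)"

definition desc :: "'v \<Rightarrow> 'v set" where
  "desc v = {x. (v, x) \<in> E\<^sup>*}"

text \<open>An edge is identified with its lower end, so that a set of edges is a subset of \<open>V - {r}\<close>.\<close>

definition edges :: "'v set \<Rightarrow> ('v \<times> 'v) set" where
  "edges F = {(u, v) \<in> E. v \<in> F}"

definition conn :: "'v set \<Rightarrow> ('v \<times> 'v) set" where
  "conn F = (edges F \<union> (edges F)\<inverse>)\<^sup>*"

definition children :: "'v \<Rightarrow> 'v set \<Rightarrow> 'v set" where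
  "children v F = {w \<in> F. (v, w) \<in> E}"

text \<open>Removing the edge above \<open>v\<close> cuts the tree into \<open>desc v\<close> and
  the rest, so T(J) needs this edge exactly if \<open>J\<close> meets both sides. For
  \<open>J\<close> within \<open>V\<close> the root drops out by itself, since all nodes lie in
  \<open>desc r\<close>.\<close>

definition subtree_edges :: "'v set \<Rightarrow> 'v set" where
  "subtree_edges J = {v \<in> V. J \<inter> desc v \<noteq> {} \<and> J - desc v \<noteq> {}}"

text \<open>\<open>J\<close> itself is added for the case of a single node, where there are no
  edges.\<close>

definition subtree_verts :: "'v set \<Rightarrow> 'v set" where
  "subtree_verts J = J \<union> subtree_edges J \<union> par ` subtree_edges J"

section \<open>Descendants and ancestors\<close>

lemma finite_E: "finite E"
  using finite_subset[OF E_subset] finite_V by blast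

lemma root_no_parent: "(u, r) \<notin> E"
proof
  assume "(u, r) \<in> E"
  moreover from this have "(r, u) \<in> E\<^sup>*" using E_subset reach by blast
  ultimately have "(u, u) \<in> E\<^sup>+" by (rule rtrancl_into_trancl2)
  then show False using acyclic_E by (simp add: acyclic_def)
qed

lemma par_eq: "(u, v) \<in> E \<Longrightarrow> par v = u"
  unfolding par_def using parent_unique by blast

lemma par_edge: "v \<in> V \<Longrightarrow> v \<noteq> r \<Longrightarrow> (par v, v) \<in> E"
  by (rule rtranclE[OF reach[of v]]) (use par_eq in blast)+

lemma edge_iff: "(u, v) \<in> E \<longleftrightarrow> v \<in> V \<and> v \<noteq> r \<and> u = par v"
  using par_edge par_eq root_no_parent E_subset by blast

lemma desc_refl: "v \<in> desc v"
  by (simp add: desc_def)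

lemma desc_trans: "x \<in> desc v \<Longrightarrow> desc x \<subseteq> desc v"
  by (auto simp: desc_def)

lemma desc_root: "V \<subseteq> desc r"
  by (auto simp: desc_def reach)

lemma edge_desc: "(u, v) \<in> E \<Longrightarrow> v \<in> desc u"
  by (auto simp: desc_def)

lemma edge_not_desc: "(u, v) \<in> E \<Longrightarrow> u \<notin> desc v"
  using acyclic_E rtrancl_into_trancl1[of v u E v] by (auto simp: acyclic_def desc_def)

lemma desc_antisym: "x \<in> desc v \<Longrightarrow> v \<in> desc x \<Longrightarrow> x = v"
  using acyclic_E rtranclD[of v x E] trancl_rtrancl_trancl[of v x E v]
  by (auto simp: acyclic_def desc_def)

lemma desc_subset_V: "v \<in> V \<Longrightarrow> desc v \<subseteq> V"
proof
  fix x assume v: "v \<in> V" and "x \<in> desc v"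
  then have "(v, x) \<in> E\<^sup>*" by (simp add: desc_def)
  then show "x \<in> V" using v E_subset by (induction) auto
qed

lemma desc_par:
  assumes "x \<in> desc v" "(u, x) \<in> E" "x \<noteq> v"
  shows "u \<in> desc v"
  using assms(1) unfolding desc_def mem_Collect_eq
  by (rule rtranclE) (use assms parent_unique in blast)+

text \<open>Parents are unique: climbing from \<open>x\<close> towards \<open>a\<close> one stays in
  \<open>desc b\<close> unless \<open>b\<close> itself is passed, and then \<open>b\<close> lies
  below \<open>a\<close>.\<close>

lemma desc_comparable:
  assumes "x \<in> desc a" "x \<in> desc b"
  shows "a \<in> desc b \<or> b \<in> desc a"
proof -
  have "(a, x) \<in> E\<^sup>*" using assms by (simp add: desc_def)
  then show ?thesis using \<open>x \<in> desc b\<close>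
  proof (induction rule: rtrancl_induct)
    case base
    then show ?case by simp
  next
    case (step y z)
    then show ?case
      using desc_par[of z b y] rtrancl_into_rtrancl[OF step.hyps] by (auto simp: desc_def)
  qed
qed

lemma siblings_disjoint:
  assumes "(u, v) \<in> E" "(u, w) \<in> E" "v \<noteq> w"
  shows "desc v \<inter> desc w = {}"
proof (rule ccontr)
  assume "desc v \<inter> desc w \<noteq> {}"
  then have "v \<in> desc w \<or> w \<in> desc v" using desc_comparable by blast
  then have "u \<in> desc w \<or> u \<in> desc v" using desc_par assms by blast
  then show False using edge_not_desc assms by blast
qed

section \<open>Connectivity within an edge set\<close>

lemma conn_refl: "(x, x) \<in> conn F"
  by (simp add: conn_def)

lemma conn_sym: "(x, y) \<in> conn F \<Longrightarrow> (y, x) \<in> conn F"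
proof -
  have "sym (edges F \<union> (edges F)\<inverse>)" by (auto simp: sym_def)
  then show "(x, y) \<in> conn F \<Longrightarrow> (y, x) \<in> conn F"
    unfolding conn_def by (rule symD[OF sym_rtrancl])
qed

lemma conn_trans: "(x, y) \<in> conn F \<Longrightarrow> (y, z) \<in> conn F \<Longrightarrow> (x, z) \<in> conn F"
  by (simp add: conn_def)

lemma conn_edge: "(u, v) \<in> E \<Longrightarrow> v \<in> F \<Longrightarrow> (u, v) \<in> conn F"
  by (auto simp: conn_def edges_def)

lemma conn_edge': "(u, v) \<in> E \<Longrightarrow> v \<in> F \<Longrightarrow> (v, u) \<in> conn F"
  using conn_edge conn_sym by blast

text \<open>Steps away from the root and towards it are kept apart, because only an upward step can
  leave a set \<open>desc v\<close>.\<close>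

lemma conn_induct [consumes 1, case_names refl down up]:
  assumes "(x, y) \<in> conn F"
    and "P x"
    and "\<And>u v. (x, u) \<in> conn F \<Longrightarrow> P u \<Longrightarrow> (u, v) \<in> E \<Longrightarrow> v \<in> F \<Longrightarrow> P v"
    and "\<And>u v. (x, v) \<in> conn F \<Longrightarrow> P v \<Longrightarrow> (u, v) \<in> E \<Longrightarrow> v \<in> F \<Longrightarrow> P u"
  shows "P y"
  using assms(1) unfolding conn_def
proof (induction rule: rtrancl_induct)
  case base
  then show ?case by (rule assms)
next
  case (step y z)
  then show ?case
    using assms(3)[of y z] assms(4)[of y z] by (auto simp: edges_def conn_def)
qed

text \<open>The edge above \<open>v\<close> is the only one joining \<open>desc v\<close> to its
  complement, so a walk in \<open>F\<close> that leaves \<open>desc v\<close> has to traverse it and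
  meets both of its ends.\<close>

lemma conn_separated:
  assumes "(i, j) \<in> conn F" "i \<in> desc v" "j \<notin> desc v"
  shows "v \<in> F \<and> (par v, v) \<in> E \<and> (i, v) \<in> conn F \<and> (i, par v) \<in> conn F"
  using assms(1,3)
proof (induction rule: conn_induct)
  case refl
  then show ?case using assms(2) by simp
next
  case (down x y)
  then show ?case using edge_desc desc_trans by blast
next
  case (up x y)
  show ?case
  proof (cases "y \<in> desc v")
    case True
    then have "y = v" using desc_par up by blast
    then show ?thesis using up.hyps par_eq[OF up.hyps(2)] conn_edge'[OF up.hyps(2,3)] conn_trans by blast
  next
    case False
    then show ?thesis using up by blast
  qed
qed

section \<open>The subtree spanned by a set of nodes\<close>

lemma subtree_edges_subset: "subtree_edges J \<subseteq> V"
  by (auto simp: subtree_edges_def)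

lemma root_notin_subtree_edges: "J \<subseteq> V \<Longrightarrow> r \<notin> subtree_edges J"
  using desc_root by (auto simp: subtree_edges_def)

lemma subtree_edges_par: "J \<subseteq> V \<Longrightarrow> v \<in> subtree_edges J \<Longrightarrow> (par v, v) \<in> E"
  using root_notin_subtree_edges subtree_edges_subset par_edge by blast

lemma subtree_verts_subset: "J \<subseteq> V \<Longrightarrow> subtree_verts J \<subseteq> V"
  using subtree_edges_par[of J] subtree_edges_subset[of J] E_subset
  unfolding subtree_verts_def by blast

lemma subtree_edges_mono: "J \<subseteq> K \<Longrightarrow> subtree_edges J \<subseteq> subtree_edges K"
  by (auto simp: subtree_edges_def)

lemma subtree_desc:
  assumes "J \<subseteq> V" "v \<in> subtree_verts J"
  shows "J \<inter> desc v \<noteq> {}"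
proof -
  consider "v \<in> J" | "v \<in> subtree_edges J" | w where "w \<in> subtree_edges J" "v = par w"
    using assms by (auto simp: subtree_verts_def)
  then show ?thesis
  proof cases
    case 3
    then have "desc w \<subseteq> desc v" using subtree_edges_par assms edge_desc desc_trans by blast
    then show ?thesis using 3 by (auto simp: subtree_edges_def)
  qed (use desc_refl in \<open>auto simp: subtree_edges_def\<close>)
qed

text \<open>Minimality of the spanned subtree: by \<open>conn_separated\<close>, an edge with
  elements of \<open>J\<close> on both sides is forced into every edge set that connects
  \<open>J\<close>.\<close>

lemma subtree_subset_connected:
  assumes J: "J \<subseteq> V" and conn: "\<And>i j. i \<in> J \<Longrightarrow> j \<in> J \<Longrightarrow> (i, j) \<in> conn G"
  shows "subtree_edges J \<subseteq> G" and "i \<in> J \<Longrightarrow> x \<in> subtree_verts J \<Longrightarrow> (i, x) \<in> conn G"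
proof -
  have *: "v \<in> G \<and> (\<forall>i\<in>J. (i, v) \<in> conn G \<and> (i, par v) \<in> conn G)" if "v \<in> subtree_edges J" for v
  proof -
    obtain a b where "a \<in> J" "a \<in> desc v" "b \<in> J" "b \<notin> desc v"
      using \<open>v \<in> subtree_edges J\<close> by (auto simp: subtree_edges_def)
    then show ?thesis
      using conn_separated[of a b G v] conn conn_trans by meson
  qed
  then show "subtree_edges J \<subseteq> G" by blast
  show "(i, x) \<in> conn G" if "i \<in> J" "x \<in> subtree_verts J"
    using that * conn by (auto simp: subtree_verts_def)
qed

lemma subtree_conn:
  assumes J: "J \<subseteq> V" and "x \<in> subtree_verts J" "(x, y) \<in> conn F" "F \<subseteq> subtree_edges J"
  shows "y \<in> subtree_verts J"
  using assms(3,2)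
proof (induction rule: conn_induct)
  case (down u v)
  then show ?case using assms(4) by (auto simp: subtree_verts_def)
next
  case (up u v)
  then have "v \<in> subtree_edges J" "u = par v" using assms(4) par_eq[of u v] by auto
  then show ?case by (simp add: subtree_verts_def)
qed

text \<open>\<open>t\<close> is the lowest common ancestor of \<open>J\<close>. No node strictly
  below \<open>t\<close> has all of \<open>J\<close> under it, so one with some element of
  \<open>J\<close> under it also has an element outside, which makes its upper edge part of the
  spanned subtree.\<close>

lemma subtree_top:
  assumes J: "J \<subseteq> V" "J \<noteq> {}"
  obtains t where "t \<in> subtree_verts J" "t \<notin> subtree_edges J" "J \<subseteq> desc t" "subtree_verts J \<subseteq> desc t"
    "\<And>x. x \<in> subtree_verts J \<Longrightarrow> (t, x) \<in> conn (subtree_edges J)"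
    "\<And>x. x \<in> subtree_verts J \<Longrightarrow> x \<notin> subtree_edges J \<Longrightarrow> x = t"
    "\<And>x. x \<in> desc t \<Longrightarrow> x \<noteq> t \<Longrightarrow> J \<inter> desc x \<noteq> {} \<Longrightarrow> x \<in> subtree_edges J"
proof -
  \<comment> \<open>The lowest common ancestor is taken as a common ancestor with the fewest
    descendants.\<close>
  have "\<exists>t. (t \<in> V \<and> J \<subseteq> desc t) \<and> (\<forall>y. y \<in> V \<and> J \<subseteq> desc y \<longrightarrow> card (desc t) \<le> card (desc y))"
    using ex_has_least_nat[of "\<lambda>t. t \<in> V \<and> J \<subseteq> desc t" r "\<lambda>t. card (desc t)"]
      root_in_V desc_root J by blast
  then obtain t where t: "t \<in> V" "J \<subseteq> desc t"
    and min: "\<And>y. y \<in> V \<Longrightarrow> J \<subseteq> desc y \<Longrightarrow> card (desc t) \<le> card (desc y)" by blast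
  have low: "\<not> J \<subseteq> desc x" if "x \<in> desc t" "x \<noteq> t" for x
  proof
    assume "J \<subseteq> desc x"
    moreover have "x \<in> V" using that t desc_subset_V by blast
    moreover have "desc x \<subset> desc t"
      using that desc_trans desc_antisym desc_refl by blast
    then have "card (desc x) < card (desc t)"
      using psubset_card_mono finite_subset[OF desc_subset_V finite_V] t by blast
    ultimately show False using min by fastforce
  qed
  have subtree_edgesI: "x \<in> subtree_edges J" if "x \<in> desc t" "x \<noteq> t" "J \<inter> desc x \<noteq> {}" for x
    using that low t desc_subset_V by (auto simp: subtree_edges_def)
  have conn_t: "(t, x) \<in> conn (subtree_edges J)" if "x \<in> desc t" "J \<inter> desc x \<noteq> {}" for x
  proof -
    have "(t, x) \<in> E\<^sup>*" using that by (simp add: desc_def)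
    then show ?thesis using that(2)
    proof (induction rule: rtrancl_induct)
      case base
      then show ?case by (simp add: conn_refl)
    next
      case (step y z)
      have "z \<in> desc t" using step by (auto simp: desc_def)
      moreover have "z \<noteq> t" using step edge_not_desc by (auto simp: desc_def)
      ultimately have "z \<in> subtree_edges J" using subtree_edgesI step by blast
      moreover have "desc z \<subseteq> desc y" using step edge_desc desc_trans by blast
      ultimately show ?case using step conn_edge conn_trans by blast
    qed
  qed
  obtain i where i: "i \<in> J" using J by blast
  have ti: "(t, i) \<in> conn (subtree_edges J)" using conn_t[of i] i t desc_refl by blast
  have "i \<in> subtree_verts J" using i by (simp add: subtree_verts_def)
  then have t_hull: "t \<in> subtree_verts J" using subtree_conn[OF J(1)] ti conn_sym by blast
  have t_edges: "t \<notin> subtree_edges J" using t by (auto simp: subtree_edges_def)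
  have "(i, x) \<in> conn (subtree_edges J)" if "x \<in> subtree_verts J" for x
  proof (rule subtree_subset_connected(2)[OF J(1) _ i that])
    fix a b assume "a \<in> J" "b \<in> J"
    then have "(t, a) \<in> conn (subtree_edges J)" "(t, b) \<in> conn (subtree_edges J)"
      using conn_t t desc_refl by blast+
    then show "(a, b) \<in> conn (subtree_edges J)" using conn_sym conn_trans by blast
  qed
  then have conn_tx: "(t, x) \<in> conn (subtree_edges J)" if "x \<in> subtree_verts J" for x
    using that ti conn_trans by blast
  then have "subtree_verts J \<subseteq> desc t"
    using conn_separated[of t _ "subtree_edges J" t] t_edges desc_refl by blast
  moreover from this have "x = t" if "x \<in> subtree_verts J" "x \<notin> subtree_edges J" for x
    using that subtree_edgesI subtree_desc[OF J(1)] by blast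
  ultimately show thesis
    using that t_hull t_edges t conn_tx subtree_edgesI by blast
qed

lemma subtree_connected:
  assumes "J \<subseteq> V" "x \<in> subtree_verts J" "y \<in> subtree_verts J"
  shows "(x, y) \<in> conn (subtree_edges J)"
proof (cases "J = {}")
  case True
  then show ?thesis using assms by (simp add: subtree_verts_def subtree_edges_def)
next
  case False
  obtain t where "\<And>x. x \<in> subtree_verts J \<Longrightarrow> (t, x) \<in> conn (subtree_edges J)"
    by (rule subtree_top[OF assms(1) False]) blast
  then show ?thesis using assms conn_sym[of t x] conn_trans[of x t _ y] by blast
qed

text \<open>\<open>card (children v F) + of_bool (v \<in> J)\<close> is the order of the local
  moment at \<open>v\<close>. Order 0 gives 0 if the edge above \<open>v\<close> is in
  \<open>F\<close>, order 1 gives 0 if it is not; the two clauses exclude just these cases.\<close>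

definition admissible :: "'v set \<Rightarrow> 'v set \<Rightarrow> bool" where
  "admissible J F \<longleftrightarrow> F \<subseteq> V - {r} \<and>
     (\<forall>v\<in>V. (v \<in> F \<longrightarrow> card (children v F) + of_bool (v \<in> J) \<noteq> 0) \<and>
            (v \<notin> F \<longrightarrow> card (children v F) + of_bool (v \<in> J) \<noteq> 1))"

lemma finite_children: "F \<subseteq> V \<Longrightarrow> finite (children v F)"
  by (rule finite_subset[OF _ finite_V]) (auto simp: children_def)

text \<open>Descent along \<open>F\<close>: a node of \<open>F\<close> outside \<open>J\<close> must
  have a child edge in \<open>F\<close>, and by finiteness this ends in \<open>J\<close>.\<close>

lemma admissible_below:
  assumes "admissible J F" "v \<in> F"
  shows "\<exists>i \<in> J \<inter> desc v. (v, i) \<in> conn F"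
  using assms(2)
proof (induction v rule: wf_induct[OF finite_acyclic_wf_converse[OF finite_E acyclic_E]])
  case (1 v)
  show ?case
  proof (cases "v \<in> J")
    case True
    then show ?thesis using desc_refl conn_refl by blast
  next
    case False
    then have "card (children v F) \<noteq> 0"
      using 1 assms(1) by (auto simp: admissible_def)
    then obtain w where w: "w \<in> F" "(v, w) \<in> E"
      by (auto simp: children_def card_eq_0_iff)
    with 1 obtain i where "i \<in> J \<inter> desc w" "(w, i) \<in> conn F" by blast
    then show ?thesis
      using desc_trans[OF edge_desc[OF w(2)]] conn_trans[OF conn_edge[OF w(2,1)]] by blast
  qed
qed

text \<open>At the upper end \<open>u\<close> of the edge there are three continuations: stop if
  \<open>u\<close> lies in \<open>J\<close>; turn down into another child edge and use
  \<open>admissible_below\<close>; if neither is possible, \<open>u\<close> would have order 1,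
  which forces the edge above \<open>u\<close> into \<open>F\<close>, and the argument repeats
  there.\<close>

lemma admissible_above:
  assumes "admissible J F" "v \<in> F"
  shows "\<exists>j \<in> J - desc v. (par v, j) \<in> conn F"
  using assms(2)
proof (induction v rule: wf_induct[OF finite_acyclic_wf[OF finite_E acyclic_E]])
  case (1 v)
  have FV: "F \<subseteq> V - {r}" using assms(1) by (simp add: admissible_def)
  define u where "u = par v"
  have uv: "(u, v) \<in> E" using FV 1 par_edge u_def by blast
  then have "u \<notin> desc v" "u \<in> V" using edge_not_desc E_subset by blast+
  consider "u \<in> J" | w where "w \<in> children u F" "w \<noteq> v" | "u \<notin> J" "children u F = {v}"
    using uv 1 by (auto simp: children_def)
  then show ?case
  proof cases
    case 1
    then show ?thesis using \<open>u \<notin> desc v\<close> conn_refl u_def by blast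
  next
    case 2
    then have w: "w \<in> F" "(u, w) \<in> E" by (auto simp: children_def)
    then obtain j where "j \<in> J \<inter> desc w" "(w, j) \<in> conn F"
      using admissible_below assms(1) by blast
    then show ?thesis
      using siblings_disjoint[OF uv w(2)] 2 conn_trans[OF conn_edge[OF w(2,1)]] u_def by blast
  next
    case 3
    then have "u \<in> F" using assms(1) \<open>u \<in> V\<close> by (auto simp: admissible_def)
    then obtain j where "j \<in> J - desc u" "(par u, j) \<in> conn F" using 1 uv by blast
    moreover have "(par u, u) \<in> E" using FV \<open>u \<in> F\<close> par_edge by blast
    ultimately show ?thesis
      using desc_trans[OF edge_desc[OF uv]] conn_trans[OF conn_edge'[of "par u" u F]] \<open>u \<in> F\<close> u_def
      by blast
  qed
qed

lemma admissible_separates: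
  assumes "admissible J F" "v \<in> F"
  obtains i j where "i \<in> J" "j \<in> J" "i \<in> desc v" "j \<notin> desc v" "(i, j) \<in> conn F"
proof -
  obtain i j where ij: "i \<in> J \<inter> desc v" "(v, i) \<in> conn F" "j \<in> J - desc v" "(par v, j) \<in> conn F"
    using admissible_below[OF assms] admissible_above[OF assms] by blast
  have "(par v, v) \<in> E"
    using assms par_edge by (auto simp: admissible_def)
  then have "(v, par v) \<in> conn F"
    using assms(2) by (rule conn_edge')
  then have "(i, j) \<in> conn F"
    using conn_trans[OF conn_sym[OF ij(2)] conn_trans[OF _ ij(4)]] by blast
  then show thesis using that ij by blast
qed

lemma admissible_subset_subtree_edges: "admissible J F \<Longrightarrow> F \<subseteq> subtree_edges J"
proof
  fix v assume *: "admissible J F" "v \<in> F"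
  then have "v \<in> V" by (auto simp: admissible_def)
  with admissible_separates[OF *] show "v \<in> subtree_edges J"
    unfolding subtree_edges_def by blast
qed

end

section \<open>Edge partitions of the spanned subtrees\<close>

lemma parcs_mk_symmetric_eq:
  "parcs (mk_symmetric (with_proj G)) = parcs G \<union> (parcs G)\<inverse>"
  by (auto simp: parcs_mk_symmetric)

text \<open>Reachability in a digraph is reflexive only on the vertex set, in contrast to the
  closure of a relation; hence the membership condition on \<open>u\<close>.\<close>

lemma reachable_mk_symmetric_iff:
  assumes "pair_wf_digraph G"
  shows "u \<rightarrow>\<^sup>*\<^bsub>with_proj (mk_symmetric (with_proj G))\<^esub> v
     \<longleftrightarrow> u \<in> pverts G \<and> (u, v) \<in> (parcs G \<union> (parcs G)\<inverse>)\<^sup>*" (is "?L \<longleftrightarrow> ?R")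
proof -
  have wf: "x \<in> pverts G \<and> y \<in> pverts G" if "(x, y) \<in> parcs G \<union> (parcs G)\<inverse>" for x y
    using pair_wf_digraph.arc_fst_in_verts[OF assms] pair_wf_digraph.arc_snd_in_verts[OF assms] that
    by fastforce
  have "?R" if "?L"
    using that unfolding reachable_def
    by (auto simp: parcs_mk_symmetric_eq dest: in_rtrancl_on_in_F rtrancl_on_rtranclI)
  moreover have "?L" if "u \<in> pverts G" "(u, v) \<in> (parcs G \<union> (parcs G)\<inverse>)\<^sup>*"
    using that(2)
  proof (induction rule: rtrancl_induct)
    case base
    then show ?case using that(1) by (simp add: reachable_def)
  next
    case (step y z)
    then show ?case using wf[of y z] unfolding reachable_def
      by (auto simp: parcs_mk_symmetric_eq intro: rtrancl_on_into_rtrancl_on)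
  qed
  ultimately show ?thesis by blast
qed

text \<open>In a symmetric digraph mutual reachability is plain reachability, so the strongly
  connected components are the classes of an equivalence relation.\<close>

lemma components_eq:
  assumes "pair_wf_digraph G"
  shows "components G = (\<lambda>u. (parcs G \<union> (parcs G)\<inverse>)\<^sup>* `` {u}) ` pverts G"
proof -
  define R where "R = (parcs G \<union> (parcs G)\<inverse>)\<^sup>*"
  have "sym (parcs G \<union> (parcs G)\<inverse>)" by (auto simp: sym_def)
  then have sym: "(x, y) \<in> R \<Longrightarrow> (y, x) \<in> R" for x y
    unfolding R_def by (rule symD[OF sym_rtrancl])
  have trans: "(x, y) \<in> R \<Longrightarrow> (y, z) \<in> R \<Longrightarrow> (x, z) \<in> R" for x y z
    unfolding R_def by (rule rtrancl_trans)
  have refl: "(x, x) \<in> R" for x by (simp add: R_def)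
  have verts: "y \<in> pverts G" if "x \<in> pverts G" "(x, y) \<in> R" for x y
  proof -
    have "x \<rightarrow>\<^sup>*\<^bsub>with_proj (mk_symmetric (with_proj G))\<^esub> y"
      using that reachable_mk_symmetric_iff[OF assms] by (simp add: R_def)
    then show ?thesis
      unfolding reachable_def by (auto dest: in_rtrancl_on_in_F)
  qed
  define scc where "scc C \<longleftrightarrow> C \<noteq> {} \<and> (\<forall>u\<in>C. \<forall>v\<in>C. u \<in> pverts G \<and> (u, v) \<in> R)
     \<and> (\<forall>u\<in>C. \<forall>v. v \<notin> C \<longrightarrow> \<not> (u \<in> pverts G \<and> (u, v) \<in> R) \<or> \<not> (v \<in> pverts G \<and> (v, u) \<in> R))" for C
  have "components G = {C. scc C}"
    unfolding components_def pre_digraph.sccs_verts_def scc_def R_def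
    by (simp add: reachable_mk_symmetric_iff[OF assms])
  moreover have "scc C \<longleftrightarrow> C \<in> (\<lambda>u. R `` {u}) ` pverts G" for C
  proof
    assume "scc C"
    then have C: "C \<noteq> {} \<and> (\<forall>u\<in>C. \<forall>v\<in>C. u \<in> pverts G \<and> (u, v) \<in> R)
     \<and> (\<forall>u\<in>C. \<forall>v. v \<notin> C \<longrightarrow> \<not> (u \<in> pverts G \<and> (u, v) \<in> R) \<or> \<not> (v \<in> pverts G \<and> (v, u) \<in> R))"
      unfolding scc_def .
    then obtain u where u: "u \<in> C" by blast
    with C have "C = R `` {u}" "u \<in> pverts G" using sym verts by blast+
    then show "C \<in> (\<lambda>u. R `` {u}) ` pverts G" by blast
  next
    assume "C \<in> (\<lambda>u. R `` {u}) ` pverts G"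
    then obtain u where u: "u \<in> pverts G" "C = R `` {u}" by blast
    then have "u \<in> C" using refl by blast
    moreover have "x \<in> pverts G \<and> (x, y) \<in> R" if "x \<in> C" "y \<in> C" for x y
      using that u verts sym[of u x] trans[of x u y] by blast
    moreover have "y \<in> C" if "x \<in> C" "(x, y) \<in> R" for x y
      using that u trans[of u x y] by blast
    ultimately show "scc C" unfolding scc_def by blast
  qed
  ultimately show ?thesis by (simp add: R_def)
qed

text \<open>A simple path that joins the ends of an edge and avoids it would close to a
  cycle.\<close>

lemma undirected_tree_bridge:
  assumes T: "undirected_tree T" and uv: "(u, v) \<in> parcs T"
  shows "(v, u) \<notin> ((parcs T - {(u, v)}) \<union> (parcs T - {(u, v)})\<inverse>)\<^sup>*"
proof
  assume con: "(v, u) \<in> ((parcs T - {(u, v)}) \<union> (parcs T - {(u, v)})\<inverse>)\<^sup>*"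
  define T' where "T' = \<lparr>pverts = pverts T, parcs = parcs T - {(u, v)}\<rparr>"
  have fin: "pair_fin_digraph T" and asym: "asym (parcs T)"
    using T by (auto simp: undirected_tree_def)
  interpret pair_fin_digraph T by (rule fin)
  have wf: "pair_wf_digraph T'"
    by unfold_locales (auto simp: T'_def dest: in_arcsD1 in_arcsD2)
  have "pair_wf_digraph (mk_symmetric (with_proj T'))"
    by (rule wf_digraph.wellformed_mk_symmetric) (use wf wf_digraph_wp_iff in blast)
  then interpret S: pair_wf_digraph "mk_symmetric (with_proj T')" .
  have "v \<rightarrow>\<^sup>*\<^bsub>with_proj (mk_symmetric (with_proj T'))\<^esub> u"
    using con uv in_arcsD2 reachable_mk_symmetric_iff[OF wf] by (simp add: T'_def)
  then obtain p where p: "S.apath v p u" using S.reachable_apath by blast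
  have walk: "set p \<subseteq> parcs T' \<union> (parcs T')\<inverse>" "pcas v p u" "distinct (pawalk_verts v p)"
    using p by (auto simp: S.apath_def S.awalk_def parcs_mk_symmetric_eq)
  have "pre_digraph.cycle (with_proj (mk_symmetric (with_proj T))) ((u, v) # p)"
    unfolding pre_digraph.cycle_def pre_digraph.awalk_def
    using walk uv in_arcsD1
    by (intro exI[of _ u])
      (auto simp: parcs_mk_symmetric_eq T'_def cas_with_proj_eq awalk_verts_with_proj_eq)
  moreover have "length ((u, v) # p) \<ge> 3"
  proof -
    \<comment> \<open>The return path has at least two arcs: it is not empty, as there are no loops,
      and a single arc would be either the removed edge or its reverse, which asymmetry
      excludes.\<close>
    have "u \<noteq> v" "(v, u) \<notin> parcs T" using asym uv by (auto dest: asymD)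
    then have "p \<noteq> []" "\<And>e. p \<noteq> [e]"
      using walk by (auto simp: T'_def)
    then show ?thesis by (cases p; cases "tl p") auto
  qed
  ultimately show False using T by (auto simp: undirected_tree_def)
qed

text \<open>Cut the walk at its first visit to \<open>x\<close>; no edge leaving \<open>x\<close>
  has been used by then.\<close>

lemma rtrancl_avoid_end:
  "(a, x) \<in> E\<^sup>* \<Longrightarrow> (a, x) \<in> (E - {x} \<times> UNIV)\<^sup>*"
proof (induction rule: converse_rtrancl_induct)
  case (step a b)
  then show ?case
    by (cases "a = x") (auto intro: converse_rtrancl_into_rtrancl)
qed simp

text \<open>A walk through the edge \<open>(w, v)\<close> would go on to reach \<open>u\<close> from
  \<open>v\<close>.\<close>

lemma rtrancl_avoid_edge:
  "(a, u) \<in> E\<^sup>* \<Longrightarrow> (v, u) \<notin> E\<^sup>* \<Longrightarrow> (a, u) \<in> (E - {(w, v)})\<^sup>*"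
proof (induction rule: converse_rtrancl_induct)
  case (step a b)
  then have "(a, b) \<in> E - {(w, v)}" by auto
  with step show ?case by (auto intro: converse_rtrancl_into_rtrancl)
qed simp

lemma rooted_tree_arborescence:
  assumes "rooted_tree T r"
  shows "rooted_arborescence (pverts T) (parcs T) r"
proof -
  define E where "E = parcs T"
  have T: "undirected_tree T" using assms by (simp add: rooted_tree_def)
  then interpret pair_fin_digraph T by (simp add: undirected_tree_def)
  have reach: "(r, v) \<in> E\<^sup>*" if "v \<in> pverts T" for v
  proof -
    have "r \<rightarrow>\<^sup>*\<^bsub>with_proj T\<^esub> v" using assms that by (simp add: rooted_tree_def)
    then show ?thesis by (simp add: reachable_def E_def rtrancl_on_rtranclI)
  qed
  have bridge: "(v, u) \<notin> ((E - {(u, v)}) \<union> (E - {(u, v)})\<inverse>)\<^sup>*" if "(u, v) \<in> E" for u v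
    using undirected_tree_bridge[OF T] that by (simp add: E_def)
  have mono: "(x, y) \<in> (E' \<union> E'\<inverse>)\<^sup>* \<and> (y, x) \<in> (E' \<union> E'\<inverse>)\<^sup>*"
    if "(x, y) \<in> F\<^sup>*" "F \<subseteq> E'" for x y F and E' :: "('a \<times> 'a) set"
  proof -
    have "(x, y) \<in> (E' \<union> E'\<inverse>)\<^sup>*"
      using that rtrancl_mono[of F "E' \<union> E'\<inverse>"] by blast
    moreover have "sym ((E' \<union> E'\<inverse>)\<^sup>*)" by (rule sym_rtrancl) (auto simp: sym_def)
    ultimately show ?thesis by (auto dest: symD)
  qed
  \<comment> \<open>A directed walk from \<open>v\<close> back to \<open>u\<close>, cut at its first
    visit to \<open>u\<close>, avoids the edge \<open>(u, v)\<close>, which therefore is no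
    bridge.\<close>
  have acyc: "(v, u) \<notin> E\<^sup>*" if "(u, v) \<in> E" for u v
  proof
    assume "(v, u) \<in> E\<^sup>*"
    then have "(v, u) \<in> (E - {u} \<times> UNIV)\<^sup>*" by (rule rtrancl_avoid_end)
    then show False using bridge[OF that] mono[of v u "E - {u} \<times> UNIV" "E - {(u, v)}"] by blast
  qed
  \<comment> \<open>With two parents, the edge from \<open>u'\<close> to \<open>v\<close> is no
    bridge: without it \<open>v\<close> is still joined to \<open>u'\<close>, up through
    \<open>u\<close> to the root and down again.\<close>
  have uniq: "u = u'" if "(u, v) \<in> E" "(u', v) \<in> E" for u u' v
  proof (rule ccontr)
    assume "u \<noteq> u'"
    let ?E = "E - {(u', v)}"
    have "u \<in> pverts T" "u' \<in> pverts T" using that in_arcsD1 by (auto simp: E_def)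
    then have "(r, u) \<in> ?E\<^sup>*" "(r, u') \<in> ?E\<^sup>*"
      using rtrancl_avoid_edge[OF reach acyc] that by blast+
    moreover have "(u, v) \<in> ?E" using that \<open>u \<noteq> u'\<close> by blast
    ultimately have "(r, v) \<in> ?E\<^sup>*" "(r, u') \<in> ?E\<^sup>*" by (auto intro: rtrancl_into_rtrancl)
    then have "(v, r) \<in> (?E \<union> ?E\<inverse>)\<^sup>*" "(r, u') \<in> (?E \<union> ?E\<inverse>)\<^sup>*"
      using mono[of r v ?E ?E] mono[of r u' ?E ?E] by blast+
    then have "(v, u') \<in> (?E \<union> ?E\<inverse>)\<^sup>*" by (rule rtrancl_trans)
    then show False using bridge[OF that(2)] by blast
  qed
  have "acyclic E"
    unfolding acyclic_def using acyc by (meson tranclD2)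
  then show ?thesis
    using reach uniq assms pair_finite_verts in_arcsD1 in_arcsD2
    by unfold_locales (auto simp: E_def rooted_tree_def)
qed

section \<open>The minimal subtree, its root and its edge partitions\<close>

locale rooted_tree_graph =
  fixes T :: "'v pair_pre_digraph" and r :: 'v
  assumes rooted: "rooted_tree T r"

sublocale rooted_tree_graph \<subseteq> rooted_arborescence "pverts T" "parcs T" r
  using rooted by (rule rooted_tree_arborescence)

context rooted_tree_graph
begin

definition subtree :: "'v set \<Rightarrow> 'v pair_pre_digraph" where
  "subtree I = \<lparr>pverts = subtree_verts I, parcs = edges (subtree_edges I)\<rparr>"

text \<open>\<open>F\<close> lists the edges that are kept. Classes are formed around elements of
  \<open>I\<close> only, so empty restrictions never arise.\<close>

definition blocks :: "'v set \<Rightarrow> 'v set \<Rightarrow> 'v set set" where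
  "blocks I F = (\<lambda>i. I \<inter> conn F `` {i}) ` I"

lemma undirected_T: "undirected_tree T"
  using rooted by (simp add: rooted_tree_def)

lemma wf_T: "pair_wf_digraph T"
  using undirected_T by (auto simp: undirected_tree_def pair_fin_digraph_def)

lemma edges_in_subtree: "I \<subseteq> pverts T \<Longrightarrow> edges (subtree_edges I) \<subseteq> subtree_verts I \<times> subtree_verts I"
  using par_eq by (force simp: edges_def subtree_verts_def)

lemma wf_subtree: 
  assumes "I \<subseteq> pverts T" "F \<subseteq> edges (subtree_edges I)"
  shows "pair_wf_digraph \<lparr>pverts = subtree_verts I, parcs = F\<rparr>"
  using edges_in_subtree[OF assms(1)] assms(2) by unfold_locales auto

lemma subtree_containing_subtree:
  assumes I: "I \<subseteq> pverts T" "I \<noteq> {}"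
  shows "subtree_containing T I (subtree I)"
proof -
  have wf: "pair_wf_digraph (subtree I)"
    using wf_subtree[OF I(1)] by (simp add: subtree_def)
  have "edges (subtree_edges I) \<subseteq> parcs T" by (auto simp: edges_def)
  then have sub: "subgraph (with_proj (subtree I)) (with_proj T)"
    using wf wf_T subtree_verts_subset[OF I(1)]
    by (intro subgraphI) (auto simp: subtree_def wf_digraph_wp_iff)
  have "pair_fin_digraph (subtree I)"
    using wf finite_subset[OF subtree_verts_subset[OF I(1)] finite_V]
      finite_subset[OF \<open>edges _ \<subseteq> parcs T\<close> finite_E]
    by (simp add: pair_fin_digraph_def pair_fin_digraph_axioms_def subtree_def)
  moreover have "asym (parcs (subtree I))"
    using undirected_T
    by (intro asymI) (auto simp: undirected_tree_def subtree_def edges_def dest: asymD)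
  moreover have "Digraph_Component.connected (with_proj (subtree I))"
  proof -
    have "subtree_verts I \<noteq> {}" using I by (auto simp: subtree_verts_def)
    then show ?thesis
      unfolding connected_def strongly_connected_def
      using reachable_mk_symmetric_iff[OF wf] subtree_connected[OF I(1)]
      by (simp add: subtree_def conn_def)
  qed
  moreover have "pre_digraph.cycle (with_proj (mk_symmetric (with_proj T))) p"
    if "pre_digraph.cycle (with_proj (mk_symmetric (with_proj (subtree I)))) p" for p
    using that subtree_verts_subset[OF I(1)] \<open>edges _ \<subseteq> parcs T\<close>
    unfolding pre_digraph.cycle_def pre_digraph.awalk_def cas_with_proj_eq awalk_verts_with_proj_eq
    by (fastforce simp: parcs_mk_symmetric_eq subtree_def)
  ultimately have "undirected_tree (subtree I)"
    using undirected_T unfolding undirected_tree_def by blast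
  moreover have "I \<subseteq> pverts (subtree I)" by (auto simp: subtree_def subtree_verts_def)
  ultimately show ?thesis using sub by (simp add: subtree_containing_def)
qed

text \<open>Parents are unique, so naming edges by their lower ends loses nothing.\<close>

lemma edges_snd_image: "A \<subseteq> parcs T \<Longrightarrow> edges (snd ` A) = A"
proof (intro set_eqI iffI; clarify)
  fix u v assume A: "A \<subseteq> parcs T" and "(u, v) \<in> edges (snd ` A)"
  then obtain u' where "(u', v) \<in> A" "(u, v) \<in> parcs T" by (auto simp: edges_def)
  then show "(u, v) \<in> A" using A parent_unique[of u v u'] by blast
next
  fix u v assume "A \<subseteq> parcs T" "(u, v) \<in> A"
  then show "(u, v) \<in> edges (snd ` A)" by (force simp: edges_def)
qed

lemma subtree_least:
  assumes I: "I \<subseteq> pverts T" "I \<noteq> {}" and S: "subtree_containing T I S"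
  shows "subgraph (with_proj (subtree I)) (with_proj S)"
proof -
  \<comment> \<open>The arcs of \<open>S\<close>, named by their lower ends, form an edge set that
    connects \<open>I\<close>, so the minimality in \<open>subtree_subset_connected\<close> applies
    to it.\<close>
  define G where "G = snd ` parcs S"
  have "undirected_tree S" and IS: "I \<subseteq> pverts S" and "parcs S \<subseteq> parcs T"
    using S by (simp_all add: subtree_containing_def subgraph_def)
  then have wf: "pair_wf_digraph S" and con: "Digraph_Component.connected (with_proj S)"
    by (auto simp: undirected_tree_def pair_fin_digraph_def)
  have edges: "edges G = parcs S"
    using edges_snd_image \<open>parcs S \<subseteq> parcs T\<close> by (simp add: G_def)
  have conn_S: "(i, j) \<in> conn G" if "i \<in> I" "j \<in> I" for i j
    using con that IS reachable_mk_symmetric_iff[OF wf]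
    by (auto simp: connected_def strongly_connected_def conn_def edges subset_iff)
  have "x \<in> pverts S" if "x \<in> subtree_verts I" for x
  proof -
    obtain i where "i \<in> I" using I by blast
    then have "(i, x) \<in> conn G" using subtree_subset_connected(2)[OF I(1) conn_S _ that] by blast
    then have "i \<rightarrow>\<^sup>*\<^bsub>with_proj (mk_symmetric (with_proj S))\<^esub> x"
      using reachable_mk_symmetric_iff[OF wf] \<open>i \<in> I\<close> IS by (auto simp: conn_def edges)
    then show ?thesis unfolding reachable_def by (auto dest: in_rtrancl_on_in_F)
  qed
  moreover have "subtree_edges I \<subseteq> G"
    using subtree_subset_connected(1)[OF I(1) conn_S] by blast
  then have "edges (subtree_edges I) \<subseteq> parcs S" using edges by (auto simp: edges_def)
  moreover have "pair_wf_digraph (subtree I)"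
    using wf_subtree[OF I(1)] by (simp add: subtree_def)
  ultimately show ?thesis
    using wf by (intro subgraphI) (auto simp: subtree_def wf_digraph_wp_iff)
qed

lemma min_subtree_eq:
  assumes I: "I \<subseteq> pverts T" "I \<noteq> {}"
  shows "min_subtree T I = subtree I"
  unfolding min_subtree_def
proof (rule the_equality)
  show "subtree_containing T I (subtree I) \<and>
      (\<forall>S'. subtree_containing T I S' \<longrightarrow> subgraph (with_proj (subtree I)) (with_proj S'))"
    using subtree_containing_subtree subtree_least I by blast
  fix S
  assume "subtree_containing T I S \<and>
      (\<forall>S'. subtree_containing T I S' \<longrightarrow> subgraph (with_proj S) (with_proj S'))"
  then have "subgraph (with_proj S) (with_proj (subtree I))"
    "subgraph (with_proj (subtree I)) (with_proj S)"
    using subtree_containing_subtree subtree_least I by blast+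
  then show "S = subtree I"
    by (intro pair_pre_digraph.equality) (auto simp: subgraph_def)
qed

lemma subtree_root:
  assumes I: "I \<subseteq> pverts T" "I \<noteq> {}" and t: "t \<in> subtree_verts I" "t \<notin> subtree_edges I"
  shows "subtree_root T I = t"
proof -
  obtain t' where top: "t' \<notin> subtree_edges I" "subtree_verts I \<subseteq> desc t'"
      "\<And>x. x \<in> subtree_verts I \<Longrightarrow> x \<notin> subtree_edges I \<Longrightarrow> x = t'"
    by (rule subtree_top[OF I]) blast
  have "t' = t" using top(3)[OF t] by simp
  have "pa T t \<inter> subtree_verts I = {}"
  proof (rule ccontr)
    assume "pa T t \<inter> subtree_verts I \<noteq> {}"
    then obtain p where "(p, t) \<in> parcs T" "p \<in> subtree_verts I" by (auto simp: pa_def)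
    then show False using top(2) edge_not_desc \<open>t' = t\<close> by blast
  qed
  moreover have "v = t" if "v \<in> subtree_verts I" "pa T v \<inter> subtree_verts I = {}" for v
  proof (rule ccontr)
    assume "v \<noteq> t"
    then have v: "v \<in> subtree_edges I" using top(3) that \<open>t' = t\<close> by blast
    then have "par v \<in> pa T v" "par v \<in> subtree_verts I"
      using subtree_edges_par[OF I(1)] by (auto simp: pa_def subtree_verts_def)
    then show False using that by blast
  qed
  ultimately show ?thesis
    unfolding subtree_root_def min_subtree_eq[OF I] subtree_def pair_pre_digraph.simps
    using t(1) by (intro the_equality conjI) blast+
qed

lemma degree_edges:
  assumes "F \<subseteq> pverts T - {r}"
  shows "degree \<lparr>pverts = A, parcs = edges F\<rparr> v = of_bool (v \<in> F) + card (children v F)"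
proof -
  have "{e \<in> edges F. snd e = v} = (if v \<in> F then {(par v, v)} else {})"
    using assms by (auto simp: edges_def edge_iff)
  then have "card {e \<in> edges F. snd e = v} = of_bool (v \<in> F)" by simp
  moreover have "{e \<in> edges F. fst e = v} = Pair v ` children v F"
    by (auto simp: edges_def children_def)
  then have "card {e \<in> edges F. fst e = v} = card (children v F)"
    by (simp add: card_image inj_on_def)
  ultimately show ?thesis
    by (simp add: degree_def in_degree_def out_degree_def in_arcs_def out_arcs_def)
qed

lemma degree_T: "degree T v = of_bool (v \<in> pverts T - {r}) + card (children v (pverts T - {r}))"
proof -
  have "parcs T = edges (pverts T - {r})" by (auto simp: edges_def edge_iff)
  then have "T = \<lparr>pverts = pverts T, parcs = edges (pverts T - {r})\<rparr>"
    by (intro pair_pre_digraph.equality) auto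
  then show ?thesis using degree_edges[of "pverts T - {r}" "pverts T" v] by simp
qed

text \<open>The poset is indexed by removed edges, \<open>blocks\<close> by kept ones; complements
  within \<open>subtree_edges I\<close> match the two. Components without elements of
  \<open>I\<close> give the empty set, which is discarded.\<close>

lemma edge_partitions_eq:
  assumes I: "I \<subseteq> pverts T" "I \<noteq> {}"
  shows "edge_partitions T I = blocks I ` Pow (subtree_edges I)"
proof -
  have parts: "{C \<inter> I | C. C \<in> components \<lparr>pverts = subtree_verts I, parcs = edges G\<rparr>} - {{}}
      = blocks I G" (is "?P = _") if G: "G \<subseteq> subtree_edges I" for G
  proof -
    have "edges G \<subseteq> edges (subtree_edges I)" using G by (auto simp: edges_def)
    then have c: "components \<lparr>pverts = subtree_verts I, parcs = edges G\<rparr>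
        = (\<lambda>u. conn G `` {u}) ` subtree_verts I"
      using components_eq[OF wf_subtree[OF I(1)]] by (simp add: conn_def)
    have "X \<in> blocks I G" if XP: "X \<in> ?P" for X
    proof -
      obtain u i where X: "X = conn G `` {u} \<inter> I" "i \<in> X"
        using XP unfolding c by blast
      then have "conn G `` {u} = conn G `` {i}" using conn_sym conn_trans by blast
      then show ?thesis using X by (auto simp: blocks_def)
    qed
    moreover have "X \<in> ?P" if Xb: "X \<in> blocks I G" for X
    proof -
      obtain i where X: "X = I \<inter> conn G `` {i}" "i \<in> I" using Xb by (auto simp: blocks_def)
      then have "i \<in> X" using conn_refl by blast
      moreover have "i \<in> subtree_verts I" using X by (simp add: subtree_verts_def)
      ultimately show ?thesis using X unfolding c by blast
    qed
    ultimately show ?thesis by blast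
  qed
  have diff: "edges (subtree_edges I) - F = edges (subtree_edges I - snd ` F)"
    if F: "F \<subseteq> edges (subtree_edges I)" for F
  proof (intro set_eqI iffI; clarify)
    fix u v assume uv: "(u, v) \<in> edges (subtree_edges I)" "(u, v) \<notin> F"
    have "v \<notin> snd ` F"
    proof
      assume "v \<in> snd ` F"
      then obtain u' where "(u', v) \<in> F" by auto
      then show False using uv F parent_unique[of u v u'] by (auto simp: edges_def)
    qed
    then show "(u, v) \<in> edges (subtree_edges I - snd ` F)" using uv by (auto simp: edges_def)
  qed (force simp: edges_def)+
  define Q where "Q F = {C \<inter> I | C. C \<in> components \<lparr>pverts = subtree_verts I,
      parcs = edges (subtree_edges I) - F\<rparr>} - {{}}" for F
  have Q: "Q F = blocks I (subtree_edges I - snd ` F)" if "F \<subseteq> edges (subtree_edges I)" for F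
    unfolding Q_def diff[OF that] by (rule parts) blast
  have "edge_partitions T I = {Q F | F. F \<subseteq> edges (subtree_edges I)}"
    unfolding edge_partitions_def min_subtree_eq[OF I] remove_edges_def subtree_def Q_def
    by simp
  also have "\<dots> = Q ` Pow (edges (subtree_edges I))" by blast
  also have "\<dots> = (\<lambda>F. blocks I (subtree_edges I - snd ` F)) ` Pow (edges (subtree_edges I))"
    using Q by (intro image_cong) auto
  also have "\<dots> = blocks I ` (\<lambda>F. subtree_edges I - snd ` F) ` Pow (edges (subtree_edges I))"
    by (simp add: image_image)
  also have "(\<lambda>F. subtree_edges I - snd ` F) ` Pow (edges (subtree_edges I)) = Pow (subtree_edges I)"
  proof -
    have "G \<in> (\<lambda>F. subtree_edges I - snd ` F) ` Pow (edges (subtree_edges I))"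
      if "G \<subseteq> subtree_edges I" for G
    proof
      show "edges (subtree_edges I - G) \<in> Pow (edges (subtree_edges I))"
        by (auto simp: edges_def)
      have "snd ` edges (subtree_edges I - G) = subtree_edges I - G"
        using subtree_edges_par[OF I(1)] by (force simp: edges_def)
      then show "G = subtree_edges I - snd ` edges (subtree_edges I - G)"
        using that by blast
    qed
    then show ?thesis by blast
  qed
  finally show ?thesis .
qed

end

section \<open>Moebius inversion\<close>

lemma moebius_sum_lower:
  assumes R: "finite R" "antisym R" "trans R" and refl: "(x, x) \<in> R" "(y, y) \<in> R" and "(x, y) \<in> R"
  shows "(\<Sum>z | (x, z) \<in> R \<and> (z, y) \<in> R. moebius R x z) = of_bool (x = y)"
proof (cases "x = y")
  case True
  then have "{z. (x, z) \<in> R \<and> (z, y) \<in> R} = {x}" using R refl by (auto dest: antisymD)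
  then show ?thesis using True by (simp add: moebius.simps)
next
  case False
  have fin: "finite {z. (x, z) \<in> R \<and> (z, y) \<in> R}"
    by (rule finite_subset[of _ "snd ` R"]) (use R in force)+
  have "(\<Sum>z | (x, z) \<in> R \<and> (z, y) \<in> R. moebius R x z)
      = moebius R x y + (\<Sum>z \<in> {z. (x, z) \<in> R \<and> (z, y) \<in> R} - {y}. moebius R x z)"
    using fin assms by (intro sum.remove) auto
  also have "{z. (x, z) \<in> R \<and> (z, y) \<in> R} - {y} = {z. (x, z) \<in> R \<and> (z, y) \<in> R \<and> z \<noteq> y}" by auto
  also have "moebius R x y = - (\<Sum>z | (x, z) \<in> R \<and> (z, y) \<in> R \<and> z \<noteq> y. moebius R x z)"
    using False R by (subst moebius.simps) simp
  finally show ?thesis using False by simp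
qed

text \<open>The recursion defines a left inverse of the zeta function, and the recursion of the dual
  order a right inverse; evaluating the triple product in two ways shows that they coincide.\<close>

lemma moebius_dual:
  assumes R: "finite R" "antisym R" "trans R" and refl: "\<And>z. z \<in> Field R \<Longrightarrow> (z, z) \<in> R"
    and xy: "(x, y) \<in> R"
  shows "moebius R x y = moebius (R\<inverse>) y x"
proof -
  define A where "A = {z. (x, z) \<in> R \<and> (z, y) \<in> R}"
  have fin: "finite A"
    unfolding A_def by (rule finite_subset[of _ "snd ` R"]) (use R in force)+
  have F: "(z, z) \<in> R" if "(z, w) \<in> R \<or> (w, z) \<in> R" for z w
    using refl that by (auto simp: Field_def)
  have A: "(z, z) \<in> R" "(x, z) \<in> R" "(z, y) \<in> R" if "z \<in> A" for z
    using that F by (auto simp: A_def)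
  have lower: "(\<Sum>z\<in>A. if (z, w) \<in> R then moebius R x z else 0) = of_bool (x = w)" if "w \<in> A" for w
  proof -
    have "{z \<in> A. (z, w) \<in> R} = {z. (x, z) \<in> R \<and> (z, w) \<in> R}"
      using A[OF that] R by (auto simp: A_def dest: transD)
    then show ?thesis
      using moebius_sum_lower[OF R _ A(1)[OF that] A(2)[OF that]] F[of x y] xy fin
      by (simp flip: sum.inter_filter)
  qed
  have upper: "(\<Sum>w\<in>A. if (z, w) \<in> R then moebius (R\<inverse>) y w else 0) = of_bool (z = y)" if "z \<in> A" for z
  proof -
    have "{w \<in> A. (z, w) \<in> R} = {w. (y, w) \<in> R\<inverse> \<and> (w, z) \<in> R\<inverse>}"
      using A[OF that] R by (auto simp: A_def dest: transD)
    moreover have "finite (R\<inverse>)" "antisym (R\<inverse>)" "trans (R\<inverse>)"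
      "(y, y) \<in> R\<inverse>" "(z, z) \<in> R\<inverse>" "(y, z) \<in> R\<inverse>"
      using R F[of y x] xy A[OF that] by auto
    note moebius_sum_lower[OF this]
    ultimately show ?thesis
      using fin by (simp add: eq_commute flip: sum.inter_filter)
  qed
  have "moebius R x y = (\<Sum>z\<in>A. moebius R x z * of_bool (z = y))"
    using fin xy F[of x y] F[of y x] by (simp add: of_bool_def A_def if_distrib cong: if_cong)
  also have "\<dots> = (\<Sum>z\<in>A. \<Sum>w\<in>A. if (z, w) \<in> R then moebius R x z * moebius (R\<inverse>) y w else 0)"
    using upper by (intro sum.cong) (auto simp: sum_distrib_left if_distrib simp flip: upper cong: if_cong)
  also have "\<dots> = (\<Sum>w\<in>A. \<Sum>z\<in>A. if (z, w) \<in> R then moebius R x z * moebius (R\<inverse>) y w else 0)"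
    by (rule sum.swap)
  also have "\<dots> = (\<Sum>w\<in>A. (\<Sum>z\<in>A. if (z, w) \<in> R then moebius R x z else 0) * moebius (R\<inverse>) y w)"
    by (auto simp: sum_distrib_right intro!: sum.cong)
  also have "\<dots> = (\<Sum>w\<in>A. if x = w then moebius (R\<inverse>) y w else 0)"
    using lower by (intro sum.cong) auto
  also have "\<dots> = moebius (R\<inverse>) y x"
    using fin xy F[of x y] F[of y x] by (simp add: A_def)
  finally show ?thesis .
qed

text \<open>A tree cumulant sums over the lower argument with the upper one fixed at the top,
  whereas the recursion sums over the upper argument; passing to the dual order bridges the
  two.\<close>

lemma moebius_sum_upper:
  assumes R: "finite R" "antisym R" "trans R" and refl: "\<And>z. z \<in> Field R \<Longrightarrow> (z, z) \<in> R"
    and xy: "(x, y) \<in> R"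
  shows "(\<Sum>z | (x, z) \<in> R \<and> (z, y) \<in> R. moebius R z y) = of_bool (x = y)"
proof -
  have F: "(x, x) \<in> R" "(y, y) \<in> R"
    using refl xy by (auto simp: Field_def)
  have "(\<Sum>z | (x, z) \<in> R \<and> (z, y) \<in> R. moebius R z y)
      = (\<Sum>z | (y, z) \<in> R\<inverse> \<and> (z, x) \<in> R\<inverse>. moebius (R\<inverse>) y z)"
    using moebius_dual[OF R refl] by (intro sum.cong) auto
  also have "\<dots> = of_bool (y = x)"
    using moebius_sum_lower[of "R\<inverse>" y x] R F xy by auto
  finally show ?thesis by auto
qed

section \<open>Moments as sums over edge sets\<close>

context rooted_tree_graph
begin

definition slope :: "'v params \<Rightarrow> 'v \<Rightarrow> real" where
  "slope \<theta> v = snd \<theta> ((par v, v), 1) - snd \<theta> ((par v, v), 0)"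

text \<open>The law of total expectation, taken as a recursion from the root, provides the centring
  constants before any expectation is computed. That they are the actual means is
  \<open>node_mean_eq\<close>.\<close>

definition mean :: "'v params \<Rightarrow> 'v \<Rightarrow> real" where
  "mean \<theta> = wfrec (parcs T)
     (\<lambda>f v. if v = r then fst \<theta> else snd \<theta> ((par v, v), 0) + slope \<theta> v * f (par v))"

lemma mean_root: "mean \<theta> r = fst \<theta>"
  unfolding mean_def by (subst wfrec[OF finite_acyclic_wf[OF finite_E acyclic_E]]) simp

lemma mean_step:
  assumes "v \<in> pverts T" "v \<noteq> r"
  shows "mean \<theta> v = snd \<theta> ((par v, v), 0) + slope \<theta> v * mean \<theta> (par v)"
  unfolding mean_def
  by (subst wfrec[OF finite_acyclic_wf[OF finite_E acyclic_E]])
    (use assms par_edge in \<open>simp add: cut_apply\<close>)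

text \<open>\<open>b\<close> tells whether the edge above \<open>v\<close> belongs to \<open>F\<close>.\<close>

definition local_prob :: "'v params \<Rightarrow> bool \<Rightarrow> 'v \<Rightarrow> nat \<Rightarrow> real" where
  "local_prob \<theta> b v y =
     (if b then 2 * real y - 1 else if y = 1 then mean \<theta> v else 1 - mean \<theta> v)"

text \<open>For \<open>b\<close> true this integrates against the signed measure with mass 1 at one
  and -1 at zero, the difference of the two conditional laws per unit of slope.\<close>

definition local_moment :: "'v params \<Rightarrow> bool \<Rightarrow> 'v \<Rightarrow> nat \<Rightarrow> real" where
  "local_moment \<theta> b v m = (\<Sum>y\<in>{0, 1}. local_prob \<theta> b v y * (real y - mean \<theta> v) ^ m)"

text \<open>The order at \<open>v\<close> counts the centred factors that land there: one from each
  child edge in \<open>F\<close>, and one if \<open>v\<close> is an index.\<close>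

definition weight :: "'v params \<Rightarrow> 'v set \<Rightarrow> 'v set \<Rightarrow> real" where
  "weight \<theta> J F = (\<Prod>v\<in>F. slope \<theta> v) *
     (\<Prod>v\<in>pverts T. local_moment \<theta> (v \<in> F) v (card (children v F) + of_bool (v \<in> J)))"

text \<open>At orders 2 and 3 without the edge above, and 1 and 2 with it, the values are powers of
  \<open>1 - 2 * mean \<theta> v\<close>, times the variance in the former case. At the next orders,
  4 and 3, the power \<open>(1 - 2 * l)\<^sup>2\<close> of the mean \<open>l\<close> would have to
  be replaced by \<open>1 - 3 * l + 3 * l\<^sup>2\<close>; this is the origin of the degree
  bound.\<close>

lemma local_moment_simps:
  "local_moment \<theta> False v 0 = 1"
  "local_moment \<theta> False v 1 = 0"
  "local_moment \<theta> False v 2 = mean \<theta> v * (1 - mean \<theta> v)"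
  "local_moment \<theta> False v 3 = mean \<theta> v * (1 - mean \<theta> v) * (1 - 2 * mean \<theta> v)"
  "local_moment \<theta> True v 0 = 0"
  "local_moment \<theta> True v 1 = 1"
  "local_moment \<theta> True v 2 = 1 - 2 * mean \<theta> v"
  by (simp_all add: local_moment_def local_prob_def algebra_simps power2_eq_square power3_eq_cube)

text \<open>The conditional probability is affine in the state of the parent; expanded around the
  mean of the parent, its constant term is the marginal law, by \<open>mean_step\<close>.\<close>

lemma node_prob_expand:
  assumes "v \<in> pverts T" "\<alpha> \<in> states (pverts T)"
  shows "node_prob T r \<theta> v \<alpha> =
    (if v = r then 0 else slope \<theta> v * (local_prob \<theta> True v (\<alpha> v) * (real (\<alpha> (par v)) - mean \<theta> (par v))))
    + local_prob \<theta> False v (\<alpha> v)"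
proof -
  have y: "\<alpha> v = 0 \<or> \<alpha> v = 1" using assms by (auto simp: states_def)
  show ?thesis
  proof (cases "v = r")
    case True
    then show ?thesis using y by (auto simp: node_prob_def local_prob_def mean_root)
  next
    case False
    then have e: "(par v, v) \<in> parcs T" using assms par_edge by blast
    then have "pa T v = {par v}" using parent_unique by (auto simp: pa_def)
    moreover have "\<alpha> (par v) = 0 \<or> \<alpha> (par v) = 1"
      using e E_subset assms by (auto simp: states_def)
    ultimately show ?thesis
      using y False mean_step[OF assms(1) False, of \<theta>]
      by (auto simp: node_prob_def local_prob_def slope_def algebra_simps)
  qed
qed

lemma children_conv: "F \<subseteq> pverts T - {r} \<Longrightarrow> children v F = {w \<in> F. par w = v}"
  by (auto simp: children_def edge_iff)

lemma joint_expand: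
  assumes J: "J \<subseteq> pverts T" and \<alpha>: "\<alpha> \<in> states (pverts T)"
  shows "joint T r \<theta> \<alpha> * (\<Prod>i\<in>J. real (\<alpha> i) - mean \<theta> i) =
    (\<Sum>F\<in>Pow (pverts T - {r}). (\<Prod>v\<in>F. slope \<theta> v) *
      (\<Prod>v\<in>pverts T. local_prob \<theta> (v \<in> F) v (\<alpha> v)
         * (real (\<alpha> v) - mean \<theta> v) ^ (card (children v F) + of_bool (v \<in> J))))"
proof -
  let ?V = "pverts T" and ?U = "\<lambda>v. real (\<alpha> v) - mean \<theta> v"
  let ?f = "\<lambda>v. if v = r then 0 else slope \<theta> v * (local_prob \<theta> True v (\<alpha> v) * ?U (par v))"
  let ?g = "\<lambda>v. local_prob \<theta> False v (\<alpha> v)"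
  have expand: "(\<Prod>v\<in>F. ?f v) * (\<Prod>v\<in>?V - F. ?g v) * (\<Prod>i\<in>J. ?U i) = (\<Prod>v\<in>F. slope \<theta> v) *
      (\<Prod>v\<in>?V. local_prob \<theta> (v \<in> F) v (\<alpha> v) * ?U v ^ (card (children v F) + of_bool (v \<in> J)))"
    if F: "F \<subseteq> ?V - {r}" for F
  proof -
    have finF: "finite F" using F finite_V finite_subset by blast
    have "par ` F \<subseteq> ?V" using F par_edge E_subset by blast
    \<comment> \<open>Each edge of \<open>F\<close> contributes the centred state of its upper end;
      grouping by upper ends leaves one power per node.\<close>
    then have "(\<Prod>v\<in>F. ?U (par v)) = (\<Prod>u\<in>?V. \<Prod>v | v \<in> F \<and> par v = u. ?U (par v))"
      using prod.group[OF finF finite_V, of par "\<lambda>v. ?U (par v)"] by simp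
    also have "\<dots> = (\<Prod>u\<in>?V. ?U u ^ card (children u F))"
      by (simp add: children_conv[OF F])
    finally have a: "(\<Prod>v\<in>F. ?U (par v)) = (\<Prod>u\<in>?V. ?U u ^ card (children u F))" .
    have b: "(\<Prod>i\<in>J. ?U i) = (\<Prod>v\<in>?V. ?U v ^ of_bool (v \<in> J))"
      using J finite_V by (intro prod.mono_neutral_cong_left) auto
    have c: "(\<Prod>v\<in>F. local_prob \<theta> True v (\<alpha> v)) * (\<Prod>v\<in>?V - F. ?g v)
        = (\<Prod>v\<in>?V. local_prob \<theta> (v \<in> F) v (\<alpha> v))"
      using F finite_V by (subst prod.subset_diff[of F ?V]) (auto simp: mult.commute)
    have "(\<Prod>v\<in>F. ?f v) = (\<Prod>v\<in>F. slope \<theta> v * (local_prob \<theta> True v (\<alpha> v) * ?U (par v)))"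
      using F by (intro prod.cong) auto
    then show ?thesis
      unfolding b using a c by (simp add: prod.distrib power_add mult_ac flip: c)
  qed
  have "joint T r \<theta> \<alpha> = (\<Prod>v\<in>?V. ?f v + ?g v)"
    unfolding joint_def using node_prob_expand \<alpha> by (intro prod.cong) auto
  also have "\<dots> = (\<Sum>F\<in>Pow ?V. (\<Prod>v\<in>F. ?f v) * (\<Prod>v\<in>?V - F. ?g v))"
    using finite_V by (rule prod_add)
  \<comment> \<open>The root has no edge above it, and accordingly \<open>?f r\<close> is 0.\<close>
  also have "\<dots> = (\<Sum>F\<in>Pow (?V - {r}). (\<Prod>v\<in>F. ?f v) * (\<Prod>v\<in>?V - F. ?g v))"
  proof (rule sum.mono_neutral_right)
    show "\<forall>F\<in>Pow ?V - Pow (?V - {r}). (\<Prod>v\<in>F. ?f v) * (\<Prod>v\<in>?V - F. ?g v) = 0"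
    proof
      fix F assume F: "F \<in> Pow ?V - Pow (?V - {r})"
      then have "r \<in> F" "finite F" using finite_V finite_subset by auto
      then have "(\<Prod>v\<in>F. ?f v) = 0" by (intro prod_zero) auto
      then show "(\<Prod>v\<in>F. ?f v) * (\<Prod>v\<in>?V - F. ?g v) = 0" by simp
    qed
  qed (use finite_V in auto)
  finally show ?thesis
    using expand by (simp add: sum_distrib_right)
qed

text \<open>Each term of \<open>joint_expand\<close> is a product of functions of one state each, so
  the sum over all states splits into a product of local sums.\<close>

lemma moment_expand:
  assumes J: "J \<subseteq> pverts T"
  shows "expect (pverts T) (joint T r \<theta>) (\<lambda>\<alpha>. \<Prod>i\<in>J. real (\<alpha> i) - mean \<theta> i)
    = (\<Sum>F\<in>Pow (pverts T - {r}). weight \<theta> J F)"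
proof -
  let ?V = "pverts T"
  let ?h = "\<lambda>F v y. local_prob \<theta> (v \<in> F) v y
         * (real y - mean \<theta> v) ^ (card (children v F) + of_bool (v \<in> J))"
  have "(\<Sum>\<alpha>\<in>states ?V. \<Prod>v\<in>?V. ?h F v (\<alpha> v)) = (\<Prod>v\<in>?V. \<Sum>y\<in>{0, 1}. ?h F v y)" for F
    unfolding states_def by (rule prod_sum_PiE[symmetric]) (simp_all add: finite_V)
  then have weight: "weight \<theta> J F = (\<Prod>v\<in>F. slope \<theta> v) * (\<Sum>\<alpha>\<in>states ?V. \<Prod>v\<in>?V. ?h F v (\<alpha> v))" for F
    by (simp only: weight_def local_moment_def)
  have "expect ?V (joint T r \<theta>) (\<lambda>\<alpha>. \<Prod>i\<in>J. real (\<alpha> i) - mean \<theta> i)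
    = (\<Sum>\<alpha>\<in>states ?V. \<Sum>F\<in>Pow (?V - {r}). (\<Prod>v\<in>F. slope \<theta> v) * (\<Prod>v\<in>?V. ?h F v (\<alpha> v)))"
    unfolding expect_def using joint_expand[OF J] by (intro sum.cong) auto
  also have "\<dots> = (\<Sum>F\<in>Pow (?V - {r}). weight \<theta> J F)"
    by (subst sum.swap) (simp add: weight sum_distrib_left)
  finally show ?thesis .
qed

lemma weight_nonzero_admissible:
  assumes "F \<subseteq> pverts T - {r}" "weight \<theta> J F \<noteq> 0"
  shows "admissible J F"
proof -
  have "local_moment \<theta> (v \<in> F) v (card (children v F) + of_bool (v \<in> J)) \<noteq> 0"
    if "v \<in> pverts T" for v
    using assms(2) that finite_V by (auto simp: weight_def)
  moreover have "m \<noteq> 0" if "local_moment \<theta> (v \<in> F) v m \<noteq> 0" "v \<in> F" for v m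
    using that local_moment_simps(5)[of \<theta> v] by (cases "m = 0") auto
  moreover have "m \<noteq> 1" if "local_moment \<theta> (v \<in> F) v m \<noteq> 0" "v \<notin> F" for v m
    using that local_moment_simps(2)[of \<theta> v] by (cases "m = 1") auto
  ultimately show ?thesis
    unfolding admissible_def using assms(1) by (intro conjI ballI impI) metis+
qed

lemma weight_eq_0: "F \<subseteq> pverts T - {r} \<Longrightarrow> \<not> F \<subseteq> subtree_edges J \<Longrightarrow> weight \<theta> J F = 0"
  using weight_nonzero_admissible admissible_subset_subtree_edges by blast

lemma subtree_edges_nonroot: "J \<subseteq> pverts T \<Longrightarrow> subtree_edges J \<subseteq> pverts T - {r}"
  using subtree_edges_subset root_notin_subtree_edges by blast

lemma moment_expand_subtree:
  assumes J: "J \<subseteq> pverts T"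
  shows "expect (pverts T) (joint T r \<theta>) (\<lambda>\<alpha>. \<Prod>i\<in>J. real (\<alpha> i) - mean \<theta> i)
    = (\<Sum>F\<in>Pow (subtree_edges J). weight \<theta> J F)"
  unfolding moment_expand[OF J]
  using subtree_edges_nonroot[OF J] finite_V weight_eq_0
  by (intro sum.mono_neutral_right) auto

text \<open>Total mass is the moment of the empty index set: only the empty edge set survives, and
  all its local factors are 1.\<close>

lemma joint_sum: "(\<Sum>\<alpha>\<in>states (pverts T). joint T r \<theta> \<alpha>) = 1"
proof -
  have "subtree_edges {} = {}" by (auto simp: subtree_edges_def)
  then have "expect (pverts T) (joint T r \<theta>) (\<lambda>\<alpha>. 1) = weight \<theta> {} {}"
    using moment_expand_subtree[of "{}" \<theta>] by simp
  then show ?thesis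
    by (simp add: expect_def weight_def children_def local_moment_simps)
qed

text \<open>No edge separates a single index, so only the empty edge set is left; it gives order 1
  without an edge above at \<open>v\<close>, hence 0.\<close>

lemma node_mean_eq:
  assumes "v \<in> pverts T"
  shows "node_mean T r \<theta> v = mean \<theta> v"
proof -
  have "subtree_edges {v} = {}"
    by (auto simp: subtree_edges_def)
  then have "expect (pverts T) (joint T r \<theta>) (\<lambda>\<alpha>. real (\<alpha> v) - mean \<theta> v) = weight \<theta> {v} {}"
    using moment_expand_subtree[of "{v}" \<theta>] assms by simp
  also have "\<dots> = 0"
    using weight_nonzero_admissible[of "{}" \<theta> "{v}"] assms
    by (cases "weight \<theta> {v} {} = 0") (auto simp: admissible_def children_def)
  finally show ?thesis
    using joint_sum[of \<theta>]
    by (simp add: expect_def node_mean_def right_diff_distrib sum_subtractf flip: sum_distrib_right)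
qed

section \<open>The law of the leaves and its central moments\<close>

lemma joint_nonneg:
  assumes \<theta>: "\<theta> \<in> param_space T" and \<alpha>: "\<alpha> \<in> states (pverts T)"
  shows "joint T r \<theta> \<alpha> \<ge> 0"
  unfolding joint_def
proof (rule prod_nonneg)
  have p: "fst \<theta> \<in> {0..1}" "snd \<theta> \<in> parcs T \<times> {0, 1} \<rightarrow>\<^sub>E {0..1}"
    using \<theta> by (simp_all add: param_space_def mem_Times_iff)
  fix v assume v: "v \<in> pverts T"
  show "node_prob T r \<theta> v \<alpha> \<ge> 0"
  proof (cases "v = r")
    case True
    then show ?thesis using p(1) by (simp add: node_prob_def Let_def)
  next
    case False
    then have e: "(par v, v) \<in> parcs T" using v par_edge by blast
    then have "pa T v = {par v}" using parent_unique by (auto simp: pa_def)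
    moreover have "\<alpha> (par v) \<in> {0, 1}"
      using e E_subset \<alpha> by (auto simp: states_def)
    then have "snd \<theta> ((par v, v), \<alpha> (par v)) \<in> {0..1}"
      using e by (intro PiE_mem[OF p(2)]) simp
    ultimately show ?thesis using False by (simp add: node_prob_def Let_def)
  qed
qed

lemma leaves_subset: "leaves T \<subseteq> pverts T"
  by (auto simp: leaves_def)

lemma finite_states: "finite A \<Longrightarrow> finite (states A)"
  by (auto simp: states_def intro: finite_PiE)

lemma expect_model_map:
  "expect (leaves T) (model_map T r \<theta>) f
    = expect (pverts T) (joint T r \<theta>) (\<lambda>\<alpha>. f (restrict \<alpha> (leaves T)))"
proof -
  let ?L = "leaves T" and ?V = "pverts T"
  have sub: "(\<lambda>\<alpha>. restrict \<alpha> ?L) ` states ?V \<subseteq> states ?L"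
  proof (rule image_subsetI)
    fix \<alpha> assume "\<alpha> \<in> states ?V"
    then show "restrict \<alpha> ?L \<in> states ?L"
      using leaves_subset unfolding states_def restrict_PiE_iff by (blast dest: PiE_mem)
  qed
  have "expect ?L (model_map T r \<theta>) f = (\<Sum>\<beta>\<in>states ?L. \<Sum>\<alpha> | \<alpha> \<in> states ?V \<and> restrict \<alpha> ?L = \<beta>.
      joint T r \<theta> \<alpha> * f (restrict \<alpha> ?L))"
    by (auto simp: expect_def model_map_def sum_distrib_right intro!: sum.cong)
  also have "\<dots> = (\<Sum>\<alpha>\<in>states ?V. joint T r \<theta> \<alpha> * f (restrict \<alpha> ?L))"
    using finite_V finite_subset[OF leaves_subset] by (intro sum.group sub finite_states) auto
  finally show ?thesis by (simp add: expect_def)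
qed

lemma model_map_distribution:
  assumes "\<theta> \<in> param_space T"
  shows "model_map T r \<theta> \<in> distributions (leaves T)"
proof -
  have "(\<Sum>\<beta>\<in>states (leaves T). model_map T r \<theta> \<beta>) = 1"
    using expect_model_map[of \<theta> "\<lambda>_. 1"] joint_sum by (simp add: expect_def)
  moreover have "model_map T r \<theta> \<beta> \<ge> 0" if "\<beta> \<in> states (leaves T)" for \<beta>
    using that joint_nonneg[OF assms] by (auto simp: model_map_def intro!: sum_nonneg)
  ultimately show ?thesis by (simp add: distributions_def model_map_def)
qed

lemma leaf_mean_eq:
  assumes "i \<in> leaves T"
  shows "leaf_mean T (model_map T r \<theta>) i = mean \<theta> i"
  using node_mean_eq[of i \<theta>] leaves_subset assms
  by (auto simp: leaf_mean_def expect_model_map node_mean_def)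

lemma central_moment_eq:
  assumes "B \<subseteq> leaves T"
  shows "central_moment T (model_map T r \<theta>) B = (\<Sum>F\<in>Pow (subtree_edges B). weight \<theta> B F)"
proof -
  have "(\<Prod>i\<in>B. real (restrict \<alpha> (leaves T) i) - leaf_mean T (model_map T r \<theta>) i)
      = (\<Prod>i\<in>B. real (\<alpha> i) - mean \<theta> i)" for \<alpha>
    using assms by (intro prod.cong) (auto simp: leaf_mean_eq subset_iff)
  then show ?thesis
    using moment_expand_subtree[of B \<theta>] assms leaves_subset
    by (simp add: central_moment_def expect_model_map)
qed

section \<open>Tree cumulants\<close>

lemma blocks_Union: "\<Union> (blocks I F) = I"
  using conn_refl by (auto simp: blocks_def)

lemma blocks_eqI: "(i, j) \<in> conn F \<Longrightarrow> I \<inter> conn F `` {i} = I \<inter> conn F `` {j}"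
  using conn_sym conn_trans by blast

lemma block_connected:
  assumes "B \<in> blocks I F" "i \<in> B"
  shows "B = I \<inter> conn F `` {i}"
proof -
  obtain j where "B = I \<inter> conn F `` {j}" using assms(1) by (auto simp: blocks_def)
  then show ?thesis using blocks_eqI[of j i F I] assms(2) by blast
qed

lemma partition_on_blocks: "partition_on I (blocks I F)"
proof (rule partition_onI)
  show "\<Union> (blocks I F) = I" by (rule blocks_Union)
  show "disjnt B B'" if "B \<in> blocks I F" "B' \<in> blocks I F" "B \<noteq> B'" for B B'
    using block_connected[OF that(1)] block_connected[OF that(2)] that(3)
    unfolding disjnt_def by blast
  show "{} \<notin> blocks I F" using conn_refl by (auto simp: blocks_def)
qed

lemma block_subtree_connected:
  assumes I: "I \<subseteq> pverts T" and B: "B \<in> blocks I F" and "i \<in> B" "x \<in> subtree_verts B"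
  shows "(i, x) \<in> conn F"
proof (rule subtree_subset_connected(2))
  have eq: "B = I \<inter> conn F `` {j}" if "j \<in> B" for j using block_connected[OF B that] .
  then show "B \<subseteq> pverts T" using assms by blast
  show "(j, k) \<in> conn F" if "j \<in> B" "k \<in> B" for j k using eq that by blast
qed (use assms in auto)

text \<open>The subtree spanned by a block stays inside the component of \<open>F\<close> that cut
  out the block, so a common node puts both blocks into one component.\<close>

lemma block_subtrees_disjoint:
  assumes I: "I \<subseteq> pverts T" and B: "B \<in> blocks I F" "B' \<in> blocks I F"
    and x: "x \<in> subtree_verts B" "x \<in> subtree_verts B'"
  shows "B = B'"
proof -
  have "B \<noteq> {}" "B' \<noteq> {}" using B partition_on_blocks by (auto simp: partition_on_def)
  then obtain i j where ij: "i \<in> B" "j \<in> B'" by blast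
  then have "(i, j) \<in> conn F"
    using block_subtree_connected[OF I B(1) _ x(1)] block_subtree_connected[OF I B(2) _ x(2)]
      conn_sym conn_trans by blast
  then show ?thesis
    using block_connected[OF B(1) ij(1)] block_connected[OF B(2) ij(2)] blocks_eqI by metis
qed

text \<open>The block subtrees share no node, so at each node at most one factor on the left is
  nontrivial, and it has the same order as on the right. All others have order 0 without an edge
  above, that is, value 1.\<close>

lemma weight_prod_blocks:
  assumes I: "I \<subseteq> pverts T" and P: "P = blocks I G"
    and g: "\<And>B. B \<in> P \<Longrightarrow> g B \<subseteq> subtree_edges B"
  shows "(\<Prod>B\<in>P. weight \<theta> B (g B)) = weight \<theta> I (\<Union>B\<in>P. g B)"
proof -
  let ?F = "\<Union>B\<in>P. g B"
  let ?c = "\<lambda>B F v. local_moment \<theta> (v \<in> F) v (card (children v F) + of_bool (v \<in> B))"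
  have finP: "finite P" using finite_subset[OF I finite_V] by (simp add: P blocks_def)
  have sub: "B \<subseteq> I" if "B \<in> P" for B using that P blocks_Union by blast
  have disj: "B = B'" if "B \<in> P" "B' \<in> P" "v \<in> subtree_verts B" "v \<in> subtree_verts B'" for B B' v
    using block_subtrees_disjoint[OF I] that P by blast
  have gv: "v \<in> subtree_verts B" if "B \<in> P" "v \<in> g B" for B v
    using g that by (auto simp: subtree_verts_def)
  have ch: "v \<in> subtree_verts B" if "B \<in> P" "w \<in> g B" "(v, w) \<in> parcs T" for B v w
    using g that par_eq[of v w] by (auto simp: subtree_verts_def)
  have fing: "finite (g B)" if "B \<in> P" for B
    using g[OF that] subtree_edges_subset finite_V finite_subset by meson
  have slopes: "(\<Prod>B\<in>P. \<Prod>v\<in>g B. slope \<theta> v) = (\<Prod>v\<in>?F. slope \<theta> v)"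
    using fing gv disj by (subst prod.UNION_disjoint[OF finP]) (auto; blast)+
  have outside: "?c B (g B) v = 1" if "B \<in> P" "v \<notin> subtree_verts B" for B v
  proof -
    have "v \<notin> g B" "children v (g B) = {}" "v \<notin> B"
      using that gv ch unfolding children_def by (blast, blast, auto simp: subtree_verts_def)
    then show ?thesis by (simp add: local_moment_simps)
  qed
  have factor: "(\<Prod>B\<in>P. ?c B (g B) v) = ?c I ?F v" for v
  proof (cases "\<exists>B\<in>P. v \<in> subtree_verts B")
    case True
    then obtain B where B: "B \<in> P" "v \<in> subtree_verts B" by blast
    have "v \<in> ?F \<longleftrightarrow> v \<in> g B" using B gv disj by blast
    moreover have "children v ?F = children v (g B)"
      using B ch disj unfolding children_def by blast
    moreover have "v \<in> I \<longleftrightarrow> v \<in> B"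
    proof
      assume "v \<in> I"
      then obtain B' where "B' \<in> P" "v \<in> B'" using P blocks_Union by blast
      then show "v \<in> B" using disj[OF _ B(1) _ B(2), of B'] by (auto simp: subtree_verts_def)
    qed (use sub B in blast)
    ultimately have "?c I ?F v = ?c B (g B) v" by simp
    also have "\<dots> = (\<Prod>B\<in>P. ?c B (g B) v)"
    proof -
      have "(\<Prod>B'\<in>P - {B}. ?c B' (g B') v) = 1"
        using B disj outside by (intro prod.neutral) blast
      then show ?thesis using prod.remove[OF finP B(1), of "\<lambda>B. ?c B (g B) v"] by simp
    qed
    finally show ?thesis by simp
  next
    case False
    then have "v \<notin> ?F" "children v ?F = {}" using gv ch by (auto simp: children_def)
    moreover have "v \<notin> I"
    proof
      assume "v \<in> I"
      then obtain B where "B \<in> P" "v \<in> B" using P blocks_Union by blast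
      then show False using False by (auto simp: subtree_verts_def)
    qed
    ultimately have "?c I ?F v = 1" by (simp add: local_moment_simps)
    then show ?thesis using False outside by (simp add: prod.neutral)
  qed
  show ?thesis
    unfolding weight_def prod.distrib slopes
    by (subst prod.swap) (simp add: factor)
qed

text \<open>Expanding the product chooses an edge set in every block subtree. By disjointness a
  choice amounts to its union, from which it is recovered by intersecting with each subtree.\<close>

lemma prod_sum_weight_blocks:
  assumes I: "I \<subseteq> pverts T" and P: "P = blocks I G"
  shows "(\<Prod>B\<in>P. \<Sum>F\<in>Pow (subtree_edges B). weight \<theta> B F)
    = (\<Sum>F\<in>Pow (\<Union>B\<in>P. subtree_edges B). weight \<theta> I F)"
proof -
  have finP: "finite P" using finite_subset[OF I finite_V] by (simp add: P blocks_def)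
  have finB: "finite (Pow (subtree_edges B))" for B
    using finite_subset[OF subtree_edges_subset finite_V] by simp
  have disj: "B = B'" if "B \<in> P" "B' \<in> P" "v \<in> subtree_edges B" "v \<in> subtree_edges B'" for B B' v
    using block_subtrees_disjoint[OF I, of B G B' v] that P by (auto simp: subtree_verts_def)
  have "(\<Prod>B\<in>P. \<Sum>F\<in>Pow (subtree_edges B). weight \<theta> B F)
      = (\<Sum>g\<in>PiE P (\<lambda>B. Pow (subtree_edges B)). \<Prod>B\<in>P. weight \<theta> B (g B))"
    by (rule prod_sum_PiE[OF finP finB])
  also have "\<dots> = (\<Sum>F\<in>Pow (\<Union>B\<in>P. subtree_edges B). weight \<theta> I F)"
  proof (rule sum.reindex_bij_witness[where i = "\<lambda>F. \<lambda>B\<in>P. F \<inter> subtree_edges B" and j = "\<lambda>g. \<Union>B\<in>P. g B"])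
    fix g assume g: "g \<in> PiE P (\<lambda>B. Pow (subtree_edges B))"
    then have gB: "g B \<subseteq> subtree_edges B" if "B \<in> P" for B using that PiE_mem by fastforce
    show "(\<lambda>B\<in>P. (\<Union>B\<in>P. g B) \<inter> subtree_edges B) = g"
    proof (rule PiE_ext[OF _ g])
      show "(\<lambda>B\<in>P. (\<Union>B\<in>P. g B) \<inter> subtree_edges B) \<in> PiE P (\<lambda>B. Pow (subtree_edges B))"
        by (subst restrict_PiE_iff) blast
      fix B assume B: "B \<in> P"
      have "(\<Union>B\<in>P. g B) \<inter> subtree_edges B = g B" using gB disj B by blast
      then show "(\<lambda>B\<in>P. (\<Union>B\<in>P. g B) \<inter> subtree_edges B) B = g B" using B by simp
    qed
    show "(\<Union>B\<in>P. g B) \<in> Pow (\<Union>B\<in>P. subtree_edges B)" using gB by blast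
    show "weight \<theta> I (\<Union>B\<in>P. g B) = (\<Prod>B\<in>P. weight \<theta> B (g B))"
      using weight_prod_blocks[OF I P gB] by simp
  next
    fix F assume F: "F \<in> Pow (\<Union>B\<in>P. subtree_edges B)"
    have "(\<Union>B\<in>P. (\<lambda>B\<in>P. F \<inter> subtree_edges B) B) = (\<Union>B\<in>P. F \<inter> subtree_edges B)" by simp
    also have "\<dots> = F" using F by blast
    finally show "(\<Union>B\<in>P. (\<lambda>B\<in>P. F \<inter> subtree_edges B) B) = F" .
    show "(\<lambda>B\<in>P. F \<inter> subtree_edges B) \<in> PiE P (\<lambda>B. Pow (subtree_edges B))"
      by (subst restrict_PiE_iff) blast
  qed
  finally show ?thesis .
qed

text \<open>Forwards, each edge of an admissible \<open>F\<close> separates two indices in one block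
  of \<open>F\<close>, hence in one block of \<open>P\<close>, whose subtree then contains the edge.
  Backwards, the block subtrees are disjoint, so a walk in \<open>F\<close> cannot pass from one to
  another.\<close>

lemma refines_blocks_iff:
  assumes I: "I \<subseteq> pverts T" and F: "admissible I F" and P: "P = blocks I G"
  shows "refines I (blocks I F) P \<longleftrightarrow> F \<subseteq> (\<Union>B\<in>P. subtree_edges B)"
proof
  assume ref: "refines I (blocks I F) P"
  show "F \<subseteq> (\<Union>B\<in>P. subtree_edges B)"
  proof
    fix v assume v: "v \<in> F"
    obtain i j where ij: "i \<in> I" "j \<in> I" "i \<in> desc v" "j \<notin> desc v" "(i, j) \<in> conn F"
      by (rule admissible_separates[OF F v])
    obtain B where "B \<in> P" "I \<inter> conn F `` {i} \<subseteq> B"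
      using ref ij(1) by (auto simp: refines_def blocks_def)
    then have "i \<in> B" "j \<in> B" "B \<in> P" using ij conn_refl by blast+
    moreover have "v \<in> pverts T" using F v by (auto simp: admissible_def)
    ultimately show "v \<in> (\<Union>B\<in>P. subtree_edges B)"
      using ij by (auto simp: subtree_edges_def)
  qed
next
  assume sub: "F \<subseteq> (\<Union>B\<in>P. subtree_edges B)"
  have disj: "B = B'" if "B \<in> P" "B' \<in> P" "v \<in> subtree_verts B" "v \<in> subtree_verts B'" for B B' v
    using block_subtrees_disjoint[OF I] that P by blast
  have closed: "x \<in> subtree_verts B" if "(i, x) \<in> conn F" "B \<in> P" "i \<in> subtree_verts B" for i x B
    using that(1)
  proof (induction rule: conn_induct)
    case refl
    then show ?case using that by simp
  next
    case (down u v)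
    then obtain B' where "B' \<in> P" "v \<in> subtree_edges B'" using sub by blast
    then show ?case
      using disj[OF that(2), of B' u] down par_eq[of u v] by (auto simp: subtree_verts_def)
  next
    case (up u v)
    then obtain B' where "B' \<in> P" "v \<in> subtree_edges B'" using sub by blast
    then show ?case
      using disj[OF that(2), of B' v] up par_eq[of u v] by (auto simp: subtree_verts_def)
  qed
  have in_own: "B \<subseteq> subtree_verts B" for B by (auto simp: subtree_verts_def)
  have "\<exists>Y\<in>P. X \<subseteq> Y" if "X \<in> blocks I F" for X
  proof -
    obtain i where i: "i \<in> I" "X = I \<inter> conn F `` {i}" using \<open>X \<in> blocks I F\<close> by (auto simp: blocks_def)
    obtain B where B: "B \<in> P" "i \<in> B" using i P blocks_Union by blast
    have "X \<subseteq> B"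
    proof
      fix j assume j: "j \<in> X"
      then obtain B' where B': "B' \<in> P" "j \<in> B'" using i P blocks_Union by blast
      have "j \<in> subtree_verts B" using closed[of i j B] i j B in_own by blast
      then show "j \<in> B" using disj[OF B(1) B'(1)] B' in_own by blast
    qed
    then show ?thesis using B by blast
  qed
  then show "refines I (blocks I F) P"
    using partition_on_blocks P by (auto simp: refines_def)
qed

text \<open>Connecting \<open>I\<close> forces all edges of the spanned subtree into
  \<open>F\<close>; admissibility forbids any others.\<close>

lemma blocks_eq_whole_iff:
  assumes I: "I \<subseteq> pverts T" "I \<noteq> {}" and F: "admissible I F"
  shows "blocks I F = {I} \<longleftrightarrow> F = subtree_edges I"
proof
  assume "F = subtree_edges I"
  then have "(i, j) \<in> conn F" if "i \<in> I" "j \<in> I" for i j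
    using subtree_connected[OF I(1)] that by (auto simp: subtree_verts_def)
  then have "I \<inter> conn F `` {i} = I" if "i \<in> I" for i using that by blast
  then show "blocks I F = {I}" using I by (auto simp: blocks_def)
next
  assume *: "blocks I F = {I}"
  have "(i, j) \<in> conn F" if "i \<in> I" "j \<in> I" for i j
    using block_connected[of I I F i] that * by blast
  then have "subtree_edges I \<subseteq> F" using subtree_subset_connected(1)[OF I(1)] by blast
  then show "F = subtree_edges I" using admissible_subset_subtree_edges[OF F] by blast
qed

lemma whole_edge_partition:
  assumes I: "I \<subseteq> pverts T" "I \<noteq> {}"
  shows "{I} \<in> edge_partitions T I"
proof -
  have "I \<inter> conn (subtree_edges I) `` {i} = I" if "i \<in> I" for i
    using subtree_connected[OF I(1)] that by (auto simp: subtree_verts_def)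
  then have "blocks I (subtree_edges I) = {I}" using I by (auto simp: blocks_def)
  then show ?thesis using edge_partitions_eq[OF I] by blast
qed

lemma edge_partition_order_props:
  assumes I: "I \<subseteq> pverts T" "I \<noteq> {}"
  shows "finite (edge_partition_order T I)" "antisym (edge_partition_order T I)"
    "trans (edge_partition_order T I)"
    "\<And>p. p \<in> Field (edge_partition_order T I) \<Longrightarrow> (p, p) \<in> edge_partition_order T I"
    "\<And>p. p \<in> edge_partitions T I \<Longrightarrow> (p, {I}) \<in> edge_partition_order T I"
proof -
  have "finite (edge_partitions T I)"
    unfolding edge_partitions_eq[OF I] using finite_subset[OF subtree_edges_subset finite_V] by simp
  then show "finite (edge_partition_order T I)"
    using finite_subset[of "edge_partition_order T I" "edge_partitions T I \<times> edge_partitions T I"]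
    by (auto simp: edge_partition_order_def)
  show "antisym (edge_partition_order T I)"
    by (rule antisymI) (auto simp: edge_partition_order_def dest: refines_asym)
  show "trans (edge_partition_order T I)"
    by (auto simp: trans_def edge_partition_order_def intro: refines_trans)
  have part: "partition_on I p" if "p \<in> edge_partitions T I" for p
    using that partition_on_blocks unfolding edge_partitions_eq[OF I] by blast
  show "(p, p) \<in> edge_partition_order T I" if "p \<in> Field (edge_partition_order T I)" for p
    using that part by (auto simp: Field_def edge_partition_order_def intro: refines_refl)
  show "(p, {I}) \<in> edge_partition_order T I" if p: "p \<in> edge_partitions T I" for p
  proof -
    have "refines I p {I}"
      using part[OF p] part[OF whole_edge_partition[OF I]] by (auto simp: refines_def partition_on_def)
    then show ?thesis using p whole_edge_partition[OF I] by (simp add: edge_partition_order_def)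
  qed
qed

text \<open>The partitions in the sum form the whole interval from \<open>blocks I F\<close> to
  \<open>{I}\<close>, so the Moebius sum vanishes unless the interval is a single point.\<close>

lemma moebius_sum_above:
  assumes I: "I \<subseteq> pverts T" "I \<noteq> {}" and F: "admissible I F"
  shows "(\<Sum>p | p \<in> edge_partitions T I \<and> F \<subseteq> (\<Union>B\<in>p. subtree_edges B).
      moebius (edge_partition_order T I) p {I}) = of_bool (F = subtree_edges I)"
proof -
  let ?R = "edge_partition_order T I"
  have P: "blocks I F \<in> edge_partitions T I"
    using admissible_subset_subtree_edges[OF F] edge_partitions_eq[OF I] by blast
  note props = edge_partition_order_props[OF I]
  have "{p \<in> edge_partitions T I. F \<subseteq> (\<Union>B\<in>p. subtree_edges B)}
      = {p. (blocks I F, p) \<in> ?R \<and> (p, {I}) \<in> ?R}"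
  proof (intro Collect_cong)
    fix p
    have "F \<subseteq> (\<Union>B\<in>p. subtree_edges B) \<longleftrightarrow> refines I (blocks I F) p" if "p \<in> edge_partitions T I"
      using that refines_blocks_iff[OF I(1) F] unfolding edge_partitions_eq[OF I] by blast
    then show "p \<in> edge_partitions T I \<and> F \<subseteq> (\<Union>B\<in>p. subtree_edges B)
        \<longleftrightarrow> (blocks I F, p) \<in> ?R \<and> (p, {I}) \<in> ?R"
      using props(5)[of p] P by (auto simp: edge_partition_order_def)
  qed
  then have "(\<Sum>p | p \<in> edge_partitions T I \<and> F \<subseteq> (\<Union>B\<in>p. subtree_edges B). moebius ?R p {I})
      = of_bool (blocks I F = {I})"
    using moebius_sum_upper[OF props(1-4) props(5)[OF P]] by simp
  then show ?thesis using blocks_eq_whole_iff[OF I F] by simp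
qed

lemma tree_cumulant_eq_weight:
  assumes I: "I \<subseteq> leaves T" "I \<noteq> {}"
  shows "tree_cumulant T (model_map T r \<theta>) I = weight \<theta> I (subtree_edges I)"
proof -
  let ?E = "\<lambda>p. \<Union>B\<in>p. subtree_edges B" and ?V = "pverts T - {r}"
  let ?m = "\<lambda>p. moebius (edge_partition_order T I) p {I}" and ?P = "edge_partitions T I"
  have IV: "I \<subseteq> pverts T" using I leaves_subset by blast
  have finP: "finite ?P"
    unfolding edge_partitions_eq[OF IV I(2)] using finite_subset[OF subtree_edges_subset finite_V] by simp
  \<comment> \<open>Extending the sums by zeros to an index set independent of \<open>p\<close>
    permits the interchange below.\<close>
  have prod: "(\<Prod>B\<in>p. central_moment T (model_map T r \<theta>) B)
      = (\<Sum>F\<in>Pow ?V. if F \<subseteq> ?E p then weight \<theta> I F else 0)" if p: "p \<in> ?P" for p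
  proof -
    obtain G where G: "p = blocks I G" using p edge_partitions_eq[OF IV I(2)] by blast
    have B: "B \<subseteq> I" if "B \<in> p" for B using that G blocks_Union by blast
    then have "?E p \<subseteq> ?V" using subtree_edges_nonroot[OF IV] subtree_edges_mono by blast
    moreover have "(\<Prod>B\<in>p. central_moment T (model_map T r \<theta>) B)
        = (\<Prod>B\<in>p. \<Sum>F\<in>Pow (subtree_edges B). weight \<theta> B F)"
      using B I(1) by (intro prod.cong refl central_moment_eq) blast
    moreover have "Pow (?E p) = {F \<in> Pow ?V. F \<subseteq> ?E p}" using calculation(1) by blast
    then have "(\<Sum>F\<in>Pow (?E p). weight \<theta> I F) = (\<Sum>F\<in>Pow ?V. if F \<subseteq> ?E p then weight \<theta> I F else 0)"
      using finite_V by (simp only:) (rule sum.inter_filter, simp)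
    ultimately show ?thesis
      using prod_sum_weight_blocks[OF IV G] by simp
  qed
  have "tree_cumulant T (model_map T r \<theta>) I
      = (\<Sum>p\<in>?P. \<Sum>F\<in>Pow ?V. if F \<subseteq> ?E p then ?m p * weight \<theta> I F else 0)"
    unfolding tree_cumulant_def using prod
    by (intro sum.cong) (auto simp: sum_distrib_left intro!: sum.cong)
  also have "\<dots> = (\<Sum>F\<in>Pow ?V. \<Sum>p\<in>?P. if F \<subseteq> ?E p then ?m p * weight \<theta> I F else 0)"
    by (rule sum.swap)
  also have "\<dots> = (\<Sum>F\<in>Pow ?V. if F = subtree_edges I then weight \<theta> I F else 0)"
  proof (rule sum.cong)
    fix F assume F: "F \<in> Pow ?V"
    have "(\<Sum>p\<in>?P. if F \<subseteq> ?E p then ?m p * weight \<theta> I F else 0)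
        = (\<Sum>p | p \<in> ?P \<and> F \<subseteq> ?E p. ?m p) * weight \<theta> I F"
      using finP by (auto simp: sum.inter_filter sum_distrib_right intro!: sum.cong)
    also have "\<dots> = (if F = subtree_edges I then weight \<theta> I F else 0)"
    \<comment> \<open>The interval argument concerns admissible \<open>F\<close>; a nonzero weight
      guarantees admissibility.\<close>
    proof (cases "weight \<theta> I F = 0")
      case False
      then show ?thesis
        using F weight_nonzero_admissible moebius_sum_above[OF IV I(2)] by simp
    qed auto
    finally show "(\<Sum>p\<in>?P. if F \<subseteq> ?E p then ?m p * weight \<theta> I F else 0)
        = (if F = subtree_edges I then weight \<theta> I F else 0)" .
  qed simp
  also have "\<dots> = weight \<theta> I (subtree_edges I)"
    using finite_V subtree_edges_nonroot[OF IV] by simp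
  finally show ?thesis .
qed

section \<open>Evaluation of the surviving weight\<close>

lemma children_le_degree:
  assumes F: "F \<subseteq> pverts T - {r}"
  shows "card (children v F) + of_bool (v \<in> F) \<le> degree T v"
proof -
  have "children v F \<subseteq> children v (pverts T - {r})" using F by (auto simp: children_def)
  then have "card (children v F) \<le> card (children v (pverts T - {r}))"
    using finite_children by (intro card_mono) auto
  moreover have "of_bool (v \<in> F) \<le> (of_bool (v \<in> pverts T - {r}) :: nat)" using F by auto
  ultimately show ?thesis unfolding degree_T by linarith
qed

text \<open>\<open>w\<close> is the first step of the path from \<open>v\<close> down to
  \<open>i\<close>; \<open>above\<close> puts it into the spanned subtree.\<close>

lemma child_in_subtree:
  assumes I: "I \<subseteq> pverts T" and v: "v \<in> subtree_verts I" and i: "i \<in> I" "i \<in> desc v" "i \<noteq> v"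
    and above: "\<And>w. w \<in> desc v \<Longrightarrow> w \<noteq> v \<Longrightarrow> I \<inter> desc w \<noteq> {} \<Longrightarrow> w \<in> subtree_edges I"
  obtains w where "w \<in> children v (subtree_edges I)" "i \<in> desc w"
proof -
  have "(v, i) \<in> (parcs T)\<^sup>*" using i by (simp add: desc_def)
  then obtain w where w: "(v, w) \<in> parcs T" "i \<in> desc w"
    using i(3) by (auto simp: desc_def elim: converse_rtranclE)
  then have "w \<in> subtree_edges I"
    using above[of w] edge_desc edge_not_desc desc_refl i(1) by blast
  then show thesis using that w by (auto simp: children_def)
qed

text \<open>A node outside \<open>I\<close> has one centred factor per child edge. Below the top
  this is its degree minus 1, and the signed moment lowers the exponent by one more; at the top it
  is the full degree, and splitting off the variance lowers the exponent by 2. The lower bounds on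
  the number of children ensure that the natural subtraction in the exponent is exact.\<close>

lemma weight_subtree:
  assumes deg: "\<forall>v\<in>pverts T - leaves T. degree T v \<le> 3"
    and I: "I \<subseteq> leaves T" "card I \<ge> 2"
  defines "t \<equiv> subtree_root T I"
  shows "weight \<theta> I (subtree_edges I) =
    mean \<theta> t * (1 - mean \<theta> t)
    * (\<Prod>v\<in>subtree_verts I - I. (1 - 2 * mean \<theta> v) ^ (degree (subtree I) v - 2))
    * (\<Prod>v\<in>subtree_edges I. slope \<theta> v)"
proof -
  let ?V = "pverts T" and ?E = "subtree_edges I" and ?S = "subtree_verts I"
  let ?c = "\<lambda>v. local_moment \<theta> (v \<in> ?E) v (card (children v ?E) + of_bool (v \<in> I))"
  let ?q = "\<lambda>v. if v \<in> ?S - I then (1 - 2 * mean \<theta> v) ^ (degree (subtree I) v - 2) else 1"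
  have IV: "I \<subseteq> ?V" using I leaves_subset by blast
  have ne: "I \<noteq> {}" using I by auto
  have finI: "finite I" using finite_subset[OF IV finite_V] .
  have two: "\<exists>j\<in>I. j \<noteq> i" for i
  proof (rule ccontr)
    assume "\<not> (\<exists>j\<in>I. j \<noteq> i)"
    then have "I \<subseteq> {i}" by blast
    then have "card I \<le> 1" using card_mono[of "{i}" I] by simp
    then show False using I by simp
  qed
  have EV: "?E \<subseteq> ?V - {r}" by (rule subtree_edges_nonroot[OF IV])
  have SV: "?S \<subseteq> ?V" by (rule subtree_verts_subset[OF IV])
  obtain s where s: "s \<in> ?S" "s \<notin> ?E" "I \<subseteq> desc s"
    "\<And>x. x \<in> ?S \<Longrightarrow> x \<notin> ?E \<Longrightarrow> x = s"
    "\<And>x. x \<in> desc s \<Longrightarrow> x \<noteq> s \<Longrightarrow> I \<inter> desc x \<noteq> {} \<Longrightarrow> x \<in> ?E"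
    and s_desc: "?S \<subseteq> desc s"
    by (rule subtree_top[OF IV ne]) blast
  have ts: "t = s" unfolding t_def by (rule subtree_root[OF IV ne s(1,2)])
  have deg3: "degree T v \<le> 3" if "v \<in> ?V" for v
    using deg that by (cases "v \<in> leaves T") (auto simp: leaves_def)
  have degS: "degree (subtree I) v = of_bool (v \<in> ?E) + card (children v ?E)" for v
    unfolding subtree_def by (rule degree_edges[OF EV])
  have fin_ch: "finite (children v ?E)" for v
    using EV by (intro finite_children) auto
  have below: "w \<in> ?E" if "v \<in> ?S" "w \<in> desc v" "w \<noteq> v" "I \<inter> desc w \<noteq> {}" for v w
  proof (rule s(5))
    show "w \<in> desc s" using that s_desc desc_trans by blast
    show "w \<noteq> s" using that s_desc desc_antisym by blast
    show "I \<inter> desc w \<noteq> {}" by fact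
  qed
  have has_child: "card (children v ?E) \<ge> 1" if v: "v \<in> ?S" "i \<in> I" "i \<in> desc v" "i \<noteq> v" for v i
  proof -
    obtain w where "w \<in> children v ?E"
      by (rule child_in_subtree[OF IV v below[OF v(1)]])
    then have "card (children v ?E) \<noteq> 0" using fin_ch[of v] by (auto simp: card_eq_0_iff)
    then show ?thesis by linarith
  qed
  have factor: "?c v = (if v = s then mean \<theta> v * (1 - mean \<theta> v) else 1) * ?q v" if v: "v \<in> ?V" for v
  proof -
    consider (out) "v \<notin> ?S" | (leaf) "v \<in> I" "v \<in> ?E" | (leaf_root) "v \<in> I" "v \<notin> ?E"
      | (inner) "v \<in> ?S" "v \<notin> I" "v \<in> ?E" | (root) "v \<in> ?S" "v \<notin> I" "v \<notin> ?E"
      by blast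
    then show ?thesis
    proof cases
      case out
      then have "v \<notin> ?E" "v \<notin> I" "v \<noteq> s" using s(1) by (auto simp: subtree_verts_def)
      moreover have "children v ?E = {}"
        using out par_eq[of v] by (auto simp: children_def subtree_verts_def)
      ultimately show ?thesis using out by (simp add: local_moment_simps)
    next
      case leaf
      \<comment> \<open>The only edge at a leaf is already the one above it, so the order is 1 and
        the factor 1.\<close>
      then have "card (children v ?E) = 0" using children_le_degree[OF EV, of v] I by (auto simp: leaves_def)
      then show ?thesis using leaf s(2) local_moment_simps(6)[of \<theta> v] by auto
    next
      case leaf_root
      \<comment> \<open>The root of \<open>T\<close> may itself be a leaf in \<open>I\<close>: its
        own centred factor and the one from its only edge give order 2, the bare variance.\<close>
      then have vs: "v = s" using s(4) by (auto simp: subtree_verts_def)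
      obtain j where "j \<in> I" "j \<noteq> v" using two by blast
      then have "card (children v ?E) \<ge> 1" using has_child[OF s(1), of j] s(3) vs by blast
      moreover have "card (children v ?E) \<le> 1" using children_le_degree[OF EV, of v] leaf_root I by (auto simp: leaves_def)
      ultimately have "card (children v ?E) + of_bool (v \<in> I) = 2" using leaf_root by simp
      then show ?thesis
        using leaf_root vs local_moment_simps(3)[of \<theta> v] by (simp add: numeral_2_eq_2)
    next
      case inner
      then obtain i where "i \<in> I" "i \<in> desc v" by (auto simp: subtree_edges_def)
      then have "card (children v ?E) \<ge> 1" using has_child inner by metis
      moreover have "card (children v ?E) + 1 \<le> 3"
        using children_le_degree[OF EV, of v] deg3[OF v] inner by simp
      ultimately have "card (children v ?E) = 1 \<or> card (children v ?E) = 2" by linarith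
      then show ?thesis
        using inner s(2) degS[of v] local_moment_simps(6,7)[of \<theta> v] by auto
    next
      case root
      then have vs: "v = s" using s(4) by blast
      have "card (children v ?E) \<le> 3"
        using children_le_degree[OF EV, of v] deg3[OF v] root by simp
      \<comment> \<open>With one child edge only, all of \<open>I\<close> would lie below it, and
        that edge would separate nothing.\<close>
      moreover have "card (children v ?E) \<ge> 2"
      proof -
        obtain i where i: "i \<in> I" using ne by blast
        then have iv: "i \<in> desc v" "i \<noteq> v" using s(3) vs root by auto
        obtain w where w: "w \<in> children v ?E" "i \<in> desc w"
          by (rule child_in_subtree[OF IV root(1) i iv below[OF root(1)]])
        then have "w \<in> ?E" by (simp add: children_def)
        then obtain j where j: "j \<in> I" "j \<notin> desc w" by (auto simp: subtree_edges_def)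
        then have jv: "j \<in> desc v" "j \<noteq> v" using s(3) vs root by auto
        obtain w' where w': "w' \<in> children v ?E" "j \<in> desc w'"
          by (rule child_in_subtree[OF IV root(1) j(1) jv below[OF root(1)]])
        have "{w, w'} \<subseteq> children v ?E" "w \<noteq> w'" using w w' j by auto
        then show ?thesis using card_mono[OF fin_ch, of "{w, w'}" v] by simp
      qed
      ultimately have "card (children v ?E) = 2 \<or> card (children v ?E) = 3" by linarith
      then show ?thesis
        using root vs degS[of v] local_moment_simps(3,4)[of \<theta> v] by auto
    qed
  qed
  have "(\<Prod>v\<in>?V. ?c v) = (\<Prod>v\<in>?V. (if v = s then mean \<theta> v * (1 - mean \<theta> v) else 1)) * (\<Prod>v\<in>?V. ?q v)"
    using factor by (simp add: prod.distrib)
  also have "(\<Prod>v\<in>?V. (if v = s then mean \<theta> v * (1 - mean \<theta> v) else 1)) = mean \<theta> s * (1 - mean \<theta> s)"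
    using finite_V subsetD[OF SV s(1)] by simp
  also have "(\<Prod>v\<in>?V. ?q v) = (\<Prod>v\<in>?S - I. (1 - 2 * mean \<theta> v) ^ (degree (subtree I) v - 2))"
    using finite_V SV by (intro prod.mono_neutral_cong_right) auto
  finally show ?thesis by (simp add: weight_def ts)
qed

lemma psi_reparam:
  assumes deg: "\<forall>v\<in>pverts T - leaves T. degree T v \<le> 3"
  shows "psi T (reparam T r \<theta>) = cumulant_coords T (model_map T r \<theta>)"
proof -
  let ?\<mu> = "\<lambda>v\<in>pverts T. 1 - 2 * node_mean T r \<theta> v"
  let ?\<eta> = "\<lambda>e\<in>parcs T. snd \<theta> (e, 1) - snd \<theta> (e, 0)"
  have \<mu>: "?\<mu> v = 1 - 2 * mean \<theta> v" if "v \<in> pverts T" for v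
    using that node_mean_eq by simp
  have leaf: "1/2 * (1 - ?\<mu> i) = leaf_mean T (model_map T r \<theta>) i" if "i \<in> leaves T" for i
  proof -
    have "i \<in> pverts T" using that leaves_subset by blast
    then show ?thesis unfolding leaf_mean_eq[OF that] by (subst \<mu>) (simp_all add: field_simps)
  qed
  have cumulant: "(let S = min_subtree T I in
          1/4 * (1 - (?\<mu> (subtree_root T I))\<^sup>2)
          * (\<Prod>v\<in>pverts S - I. ?\<mu> v ^ (degree S v - 2))
          * (\<Prod>e\<in>parcs S. ?\<eta> e)) = tree_cumulant T (model_map T r \<theta>) I"
    if I: "I \<in> index_sets T" for I
  proof -
    have IL: "I \<subseteq> leaves T" "card I \<ge> 2" using I by (auto simp: index_sets_def)
    then have IV: "I \<subseteq> pverts T" "I \<noteq> {}" using leaves_subset by auto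
    obtain s where s: "s \<in> subtree_verts I" "s \<notin> subtree_edges I"
      by (rule subtree_top[OF IV]) blast
    have rV: "subtree_root T I \<in> pverts T"
      using subtree_root[OF IV s] s subtree_verts_subset[OF IV(1)] by blast
    have "bij_betw snd (edges (subtree_edges I)) (subtree_edges I)"
      unfolding bij_betw_def
    proof
      show "inj_on snd (edges (subtree_edges I))"
        using parent_unique by (auto simp: inj_on_def edges_def)
      show "snd ` edges (subtree_edges I) = subtree_edges I"
        using subtree_edges_par[OF IV(1)] by (force simp: edges_def)
    qed
    then have "(\<Prod>v\<in>subtree_edges I. slope \<theta> v) = (\<Prod>e\<in>edges (subtree_edges I). slope \<theta> (snd e))"
      by (simp add: prod.reindex_bij_betw)
    also have "\<dots> = (\<Prod>e\<in>edges (subtree_edges I). ?\<eta> e)"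
      by (rule prod.cong) (auto simp: edges_def slope_def par_eq)
    finally have \<eta>: "(\<Prod>v\<in>subtree_edges I. slope \<theta> v) = (\<Prod>e\<in>edges (subtree_edges I). ?\<eta> e)" .
    have prod: "(\<Prod>v\<in>subtree_verts I - I. ?\<mu> v ^ (degree (subtree I) v - 2))
        = (\<Prod>v\<in>subtree_verts I - I. (1 - 2 * mean \<theta> v) ^ (degree (subtree I) v - 2))"
      using subtree_verts_subset[OF IV(1)] by (intro prod.cong) (auto simp: node_mean_eq subset_iff)
    \<comment> \<open>The constant 1/4 comes from
      \<open>1 - (1 - 2 * l)\<^sup>2 = 4 * l * (1 - l)\<close>, four times the variance for mean
      \<open>l\<close>.\<close>
    have var: "1/4 * (1 - (?\<mu> (subtree_root T I))\<^sup>2)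
        = mean \<theta> (subtree_root T I) * (1 - mean \<theta> (subtree_root T I))"
      unfolding \<mu>[OF rV] by (simp add: power2_eq_square algebra_simps)
    have S: "pverts (subtree I) = subtree_verts I" "parcs (subtree I) = edges (subtree_edges I)"
      by (simp_all add: subtree_def)
    show ?thesis
      unfolding tree_cumulant_eq_weight[OF IL(1) IV(2)] weight_subtree[OF deg IL] min_subtree_eq[OF IV]
        Let_def S prod var \<eta> ..
  qed
  show ?thesis
    unfolding psi_def reparam_def cumulant_coords_def prod.case
    by (intro arg_cong2[of _ _ _ _ Pair] restrict_ext leaf cumulant)
qed

end

theorem proposition4p1:
  fixes T :: "'v pair_pre_digraph" and r :: 'v
  assumes "rooted_tree T r"
    and "\<forall>v \<in> pverts T - leaves T. degree T v \<le> 3"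
  shows "psi T \<in> new_param_space T r \<rightarrow> cumulant_space T
    \<and> cumulant_model T r = psi T ` new_param_space T r"
proof -
  interpret rooted_tree_graph T r using assms(1) by unfold_locales
  \<comment> \<open>The composites \<open>psi T\<close> after \<open>reparam\<close> and
    \<open>cumulant_coords T\<close> after \<open>model_map\<close> agree at every parameter, so
    their images agree; the range is right because \<open>model_map\<close> yields distributions on
    \<open>param_space T\<close>.\<close>
  show ?thesis
    unfolding cumulant_model_def markov_model_def new_param_space_def cumulant_space_def image_image
    using psi_reparam[OF assms(2)] model_map_distribution by auto
qed

end
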